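(* Let $m\ge2$. The asymptotic probability that a random node in the random $m$-ary search tree $T_n$ is $2$-protected, i.e. the almost sure limit $P_2=P_2(m)$ as $n\to\infty$ of the fraction of nodes of $T_n$ that are $2$-protected, is $$P_2(m)=\frac{2}{m}\sum_{\ell=0}^{m-1}\frac{m!}{(m-\ell)!}\cdot\frac{(m(m-\ell))!}{(m(m-\ell)+\ell+1)!}.$$
   Context: $m$-ary search tree: each node holds up to $m-1$ keys (distinct reals). Start with an empty root. The first $m-1$ keys are stored in the root; when the root becomes full, $m$ new empty nodes are added as its children $1,\dots,m$. The $m-1$ keys divide $\mathbb R$ into intervals $J_1,\dots,J_m$; each further key lying in $J_i$ is passed to child $i$, where the same rule is applied recursively. Finally all empty nodes are deleted; the $m$-ary search tree consists of the nodes containing at least one key. $T_n$ is the tree built from the first $n$ terms of an i.i.d. sequence of keys with a continuous distribution. The rank of a node in a rooted tree is the smallest distance to a descendant that is a leaf (a leaf has rank 0). A node is $k$-protected if its rank is at least $k$; thus a node is 2-protected iff it is not a leaf and has no child that is a leaf. *)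

theory Defs
  imports "HOL-Probability.Probability"
begin

text \<open>
  A node with its set of keys and its list of children. The children list is empty as long as
  the node is not full, and afterwards consists of \<open>m\<close> (possibly empty) nodes.
\<close>
datatype mtree = Node (node_keys: "real set") (node_children: "mtree list")

definition empty_node :: mtree where
  "empty_node = Node {} []"

text \<open>
  The keys of a full node \<open>Node K cs\<close> split the line into \<open>m\<close> intervals; numbering them from \<open>0\<close>,
  a new key \<open>x\<close> lies in the interval whose index is the number of keys in \<open>K\<close> below \<open>x\<close>.
  The test for \<open>i < length cs\<close> always succeeds for trees grown from \<open>empty_node\<close>
  with \<open>m \<ge> 2\<close>; it only serves termination.
\<close>
function insert_key :: "nat \<Rightarrow> real \<Rightarrow> mtree \<Rightarrow> mtree" where
  "insert_key m x (Node K cs) =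
     (if card K < m - 1 then
        Node (insert x K) (if card (insert x K) = m - 1 then replicate m empty_node else [])
      else
        (let i = card {k \<in> K. k < x} in
         if i < length cs then Node K (cs[i := insert_key m x (cs ! i)]) else Node K cs))"
  by pat_completeness auto
termination
proof (relation "Wellfounded.measure (\<lambda>(m, x, t). size t)", goal_cases)
  case 1
  show ?case by simp
next
  case (2 m x K cs i)
  then have "cs ! i \<in> set cs"
    by simp
  then have "size (cs ! i) < Suc (size_list size cs)"
    by (meson le_imp_less_Suc order_refl size_list_estimation')
  then show ?case
    by simp
qed

definition search_tree :: "nat \<Rightarrow> real list \<Rightarrow> mtree" where
  "search_tree m xs = fold (insert_key m) xs empty_node"

text \<open>
  Nodes are addressed by the path of child indices leading to them from the root \<open>[]\<close>.
\<close>
fun subtree_at :: "mtree \<Rightarrow> nat list \<Rightarrow> mtree option" where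
  "subtree_at t [] = Some t"
| "subtree_at (Node K cs) (i # p) = (if i < length cs then subtree_at (cs ! i) p else None)"

text \<open>
  The addresses of the nodes that remain once all empty nodes have been deleted.
\<close>
definition nodes :: "mtree \<Rightarrow> nat list set" where
  "nodes t = {v. \<exists>s. subtree_at t v = Some s \<and> node_keys s \<noteq> {}}"

text \<open>
  A rooted tree is represented by the prefix-closed set \<open>V\<close> of the addresses of its nodes.
  The descendants of \<open>v\<close> (including \<open>v\<close>) are the nodes \<open>v @ w\<close>, at distance \<open>length w\<close> from \<open>v\<close>.
\<close>
definition is_leaf :: "nat list set \<Rightarrow> nat list \<Rightarrow> bool" where
  "is_leaf V v \<longleftrightarrow> v \<in> V \<and> (\<forall>i. v @ [i] \<notin> V)"

definition rank :: "nat list set \<Rightarrow> nat list \<Rightarrow> nat" where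
  "rank V v = (LEAST d. \<exists>w. is_leaf V (v @ w) \<and> length w = d)"

definition protected_nodes :: "nat \<Rightarrow> nat list set \<Rightarrow> nat list set" where
  "protected_nodes k V = {v \<in> V. k \<le> rank V v}"

definition protected_fraction :: "nat \<Rightarrow> nat list set \<Rightarrow> real" where
  "protected_fraction k V = real (card (protected_nodes k V)) / real (card V)"

end

theory Submission
  imports Defs
begin

text \<open>
  A functional of the tree that sums a local statistic over all nodes changes, when the next key falls
  into a uniformly random gap, in the mean by another functional of this kind. For the numbers of nodes
  whose \<open>m\<close> children have prescribed sizes, capped at \<open>m\<close>, these equations close up: the sizes at most
  \<open>m - 2\<close> form a cyclic linear system, for which a quadratic Lyapunov function contracts, and everything
  else is driven triangularly by it. Hence the second moment of \<open>Z n - z * (n + 1)\<close> is \<open>O(n powr \<beta>)\<close> for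
  some \<open>\<beta> < 2\<close>. Since \<open>Z n\<close> has bounded increments, this already gives \<open>Z n / n \<longlonglongrightarrow> z\<close> almost surely.
  The limits of the profile counts are beta integrals, and a node is 2-protected iff its profile consists
  of \<open>0\<close> and \<open>m\<close> only and is not zero; choosing the \<open>l\<close> zeros gives the formula.
\<close>

text \<open>Why gaps: almost surely the ranks of the keys among their predecessors are independent
  and uniform, and the rank of a new key among all keys of the tree is the number of the gap that it
  hits; so the tree can be replaced by its shape. Why the cap \<open>m\<close>: a node is a leaf iff
  its subtree has fewer than \<open>m\<close> keys, so sizes beyond \<open>m\<close> tell nothing
  more about protection, and finitely many profiles remain. Why a quadratic functional: the
  eigenvalues of the cyclic system depend on \<open>m\<close>, and for large \<open>m\<close> the
  fluctuations are known to exceed the order \<open>sqrt n\<close>, so no variance bound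
  \<open>O(n)\<close> holds for all \<open>m\<close>. Any spectral gap yields some
  \<open>\<beta> < 2\<close>. This is enough, because bounded increments make a deviation of order
  \<open>n\<close> persist for a time of order \<open>n\<close>, too long for a convergent series of
  \<open>(Z n - z * (n + 1))\<^sup>2 / (n + 1) ^ 3\<close>. All limits are taken per gap and share
  the factor \<open>size_const\<close>, which cancels in the final quotient.\<close>

section \<open>Shapes of search trees\<close>

text \<open>Only the number of keys of a node matters, and inserting a key amounts to choosing one of the
  gaps of the tree; they are numbered from left to right, starting at 0.\<close>
datatype shape = Shape nat "shape list"

fun ssize :: "shape \<Rightarrow> nat" where
  "ssize (Shape k cs) = k + sum_list (map ssize cs)"

fun cnt :: "(shape \<Rightarrow> real) \<Rightarrow> shape \<Rightarrow> real" where
  "cnt f (Shape k cs) = f (Shape k cs) + sum_list (map (cnt f) cs)"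

text \<open>A tree with \<open>n\<close> keys has \<open>n + 1\<close> gaps, hence the
  \<open>Suc\<close>.\<close>

abbreviation gaps :: "shape list \<Rightarrow> nat" where
  "gaps cs \<equiv> \<Sum>c\<leftarrow>cs. Suc (ssize c)"

lemma sum_lessThan_add:
  fixes F :: "nat \<Rightarrow> 'c::comm_monoid_add"
  shows "(\<Sum>r<a + b. F r) = (\<Sum>r<a. F r) + (\<Sum>r<b. F (r + a))"
  by (induction b) (simp_all add: add.assoc add.commute[of a])

lemma sum_list_map_update:
  fixes f :: "'b \<Rightarrow> 'c::comm_monoid_add"
  assumes "i < length xs"
  shows "sum_list (map f (xs[i := x])) + f (xs ! i) = sum_list (map f xs) + f x"
  using assms
proof (induction xs arbitrary: i)
  case (Cons y xs)
  show ?case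
  proof (cases i)
    case 0
    then show ?thesis by (simp add: ac_simps)
  next
    case (Suc j)
    then show ?thesis using Cons.IH[of j] Cons.prems by (simp add: add.assoc)
  qed
qed simp

lemma sum_list_map_update_diff:
  fixes f :: "'b \<Rightarrow> 'c::ab_group_add"
  assumes "i < length xs"
  shows "sum_list (map f (xs[i := x])) = sum_list (map f xs) + f x - f (xs ! i)"
  unfolding eq_diff_eq by (rule sum_list_map_update[OF assms])

lemma sum_list_map_update_Suc:
  assumes "i < length xs" "f x = Suc (f (xs ! i))"
  shows "sum_list (map f (xs[i := x])) = Suc (sum_list (map f xs))"
  using sum_list_map_update[OF assms(1), of f x] assms(2) by simp

locale mary =
  fixes m :: nat
  assumes m_ge_2: "2 \<le> m"
begin

text \<open>In a node with room every gap leads to the same shape, so \<open>r\<close> is ignored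
  there; in a list of children, \<open>r\<close> is reduced by the gaps of each child passed
  over.\<close>

fun grow :: "nat \<Rightarrow> shape \<Rightarrow> shape" and grow_child :: "nat \<Rightarrow> shape list \<Rightarrow> shape list" where
  "grow r (Shape k cs) =
     (if k < m - 1 then Shape (Suc k) (if Suc k = m - 1 then replicate m (Shape 0 []) else [])
      else Shape k (grow_child r cs))"
| "grow_child r [] = []"
| "grow_child r (c # cs) =
     (if r \<le> ssize c then grow r c # cs else c # grow_child (r - Suc (ssize c)) cs)"

fun wf_shape :: "shape \<Rightarrow> bool" where
  "wf_shape (Shape k cs) \<longleftrightarrow>
     (if k < m - 1 then cs = [] else k = m - 1 \<and> length cs = m \<and> (\<forall>c\<in>set cs. wf_shape c))"

lemma grow_child_offset:
  assumes "i < length cs" "r \<le> ssize (cs ! i)"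
  shows "grow_child (gaps (take i cs) + r) cs = cs[i := grow r (cs ! i)]"
  using assms by (induction cs arbitrary: i) (auto split: nat.split simp: nth_Cons less_Suc_eq_0_disj)

text \<open>Choosing a gap of a full node amounts to choosing a child and one of its own gaps. This
  is what lets a drift split over the children.\<close>

lemma sum_grow_child:
  fixes F :: "shape list \<Rightarrow> real"
  shows "(\<Sum>r<gaps cs. F (grow_child r cs)) =
    (\<Sum>i<length cs. \<Sum>r\<le>ssize (cs ! i). F (cs[i := grow r (cs ! i)]))"
proof (induction cs arbitrary: F)
  case (Cons c cs)
  have "(\<Sum>r<gaps (c # cs). F (grow_child r (c # cs))) =
     (\<Sum>r<Suc (ssize c). F (grow_child r (c # cs))) +
     (\<Sum>r<gaps cs. F (grow_child (r + Suc (ssize c)) (c # cs)))"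
    by (simp only: list.map sum_list.Cons sum_lessThan_add)
  also have "(\<Sum>r<Suc (ssize c). F (grow_child r (c # cs))) = (\<Sum>r\<le>ssize c. F (grow r c # cs))"
    by (intro sum.cong) auto
  also have "(\<Sum>r<gaps cs. F (grow_child (r + Suc (ssize c)) (c # cs))) =
      (\<Sum>r<gaps cs. (\<lambda>l. F (c # l)) (grow_child r cs))"
    by simp
  also have "\<dots> = (\<Sum>i<length cs. \<Sum>r\<le>ssize (cs ! i). F (c # cs[i := grow r (cs ! i)]))"
    by (rule Cons.IH)
  finally show ?case
    by (simp add: sum.lessThan_Suc_shift del: sum.lessThan_Suc)
qed simp

lemma grow_child_cases:
  assumes "r < gaps cs"
  obtains i r' where "i < length cs" "r' \<le> ssize (cs ! i)" "grow_child r cs = cs[i := grow r' (cs ! i)]"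
  using assms
proof (induction cs arbitrary: r thesis)
  case (Cons c cs)
  show ?case
  proof (cases "r \<le> ssize c")
    case True
    then show ?thesis using Cons.prems(1)[of 0 r] by simp
  next
    case False
    then have "r - Suc (ssize c) < gaps cs" using Cons.prems by simp
    then obtain i r' where "i < length cs" "r' \<le> ssize (cs ! i)"
       "grow_child (r - Suc (ssize c)) cs = cs[i := grow r' (cs ! i)]"
      using Cons.IH by blast
    then show ?thesis using False Cons.prems(1)[of "Suc i" r'] by simp
  qed
qed simp

lemma gaps_eq: "gaps cs = sum_list (map ssize cs) + length cs"
  by (induction cs) auto

text \<open>In the fourth conclusion, the \<open>m - 1\<close> own keys plus one match the number of
  children: a full node has no gaps besides those of its children.\<close>

lemma wf_shape_full:
  assumes "wf_shape (Shape k cs)" "\<not> k < m - 1"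
  shows "k = m - 1" "length cs = m" "c \<in> set cs \<Longrightarrow> wf_shape c" "Suc (ssize (Shape k cs)) = gaps cs"
    "i < m \<Longrightarrow> wf_shape (cs ! i)"
  using assms m_ge_2 by (auto simp: gaps_eq)

lemma grow_wf:
  assumes "wf_shape t" "r \<le> ssize t"
  shows "wf_shape (grow r t) \<and> ssize (grow r t) = Suc (ssize t)"
  using assms
proof (induction t arbitrary: r)
  case (Shape k cs)
  show ?case
  proof (cases "k < m - 1")
    case True
    then show ?thesis using Shape.prems m_ge_2 by (auto simp: sum_list_replicate)
  next
    case False
    note full = wf_shape_full[OF Shape.prems(1) False]
    have "r < gaps cs" using Shape.prems(2) full(4) by linarith
    then obtain i r' where i: "i < length cs" "r' \<le> ssize (cs ! i)"
      "grow_child r cs = cs[i := grow r' (cs ! i)]" by (rule grow_child_cases)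
    have "wf_shape (grow r' (cs ! i)) \<and> ssize (grow r' (cs ! i)) = Suc (ssize (cs ! i))"
      using Shape.IH[of "cs ! i" r'] i full by auto
    then show ?thesis using False full i
      by (auto simp: sum_list_map_update_Suc dest!: set_update_subset_insert[THEN subsetD])
  qed
qed

lemmas wf_shape_grow = grow_wf[THEN conjunct1] and ssize_grow = grow_wf[THEN conjunct2]

text \<open>Each of the \<open>m - 1\<close> insertions that fill a node with \<open>m - 2\<close> keys creates \<open>m\<close> empty children;
  they are the last summand.\<close>
definition drift :: "(shape \<Rightarrow> real) \<Rightarrow> shape \<Rightarrow> real" where
  "drift f t = (\<Sum>r\<le>ssize t. f (grow r t) - f t) +
     (case t of Shape k cs \<Rightarrow> if Suc k = m - 1 then real ((m - 1) * m) * f (Shape 0 []) else 0)"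

text \<open>Structural induction. At a full root, each gap changes \<open>f\<close> at the root and
  the sum over one child; \<open>sum_grow_child\<close> regroups the latter into sums over all gaps
  of each child, where the induction hypothesis applies.\<close>

lemma sum_cnt_grow:
  assumes "wf_shape t"
  shows "(\<Sum>r\<le>ssize t. cnt f (grow r t) - cnt f t) = cnt (drift f) t"
  using assms
proof (induction t)
  case (Shape k cs)
  show ?case
  proof (cases "k < m - 1")
    case True
    then have [simp]: "cs = []" using Shape.prems by simp
    show ?thesis
    proof (cases "Suc k = m - 1")
      case eq: True
      \<comment> \<open>All \<open>k + 1 = m - 1\<close> gaps fill the node, and each filling adds
        \<open>m\<close> empty children: the extra term of \<open>drift\<close>.\<close>
      then have "real m = real k + 2" by linarith
      with eq show ?thesis by (simp add: drift_def sum_list_replicate algebra_simps map_replicate_const)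
    next
      case False
      then show ?thesis using True by (simp add: drift_def)
    qed
  next
    case False
    note full = wf_shape_full[OF Shape.prems(1) False]
    let ?f = "\<lambda>l. f (Shape k l) - f (Shape k cs)"
    let ?c = "\<lambda>l. sum_list (map (cnt f) l) - sum_list (map (cnt f) cs)"
    have "{..ssize (Shape k cs)} = {..<gaps cs}" using full(4) by auto
    then have "(\<Sum>r\<le>ssize (Shape k cs). cnt f (grow r (Shape k cs)) - cnt f (Shape k cs)) =
      (\<Sum>r\<le>ssize (Shape k cs). f (grow r (Shape k cs)) - f (Shape k cs)) + (\<Sum>r<gaps cs. ?c (grow_child r cs))"
      using False by (simp add: sum.distrib[symmetric] algebra_simps del: ssize.simps)
    also have "(\<Sum>r<gaps cs. ?c (grow_child r cs)) =
       (\<Sum>i<length cs. \<Sum>r\<le>ssize (cs ! i). ?c (cs[i := grow r (cs ! i)]))"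
      by (rule sum_grow_child)
    also have "\<dots> = (\<Sum>i<length cs. \<Sum>r\<le>ssize (cs ! i). cnt f (grow r (cs ! i)) - cnt f (cs ! i))"
      by (intro sum.cong refl) (simp add: sum_list_map_update_diff)
    also have "\<dots> = (\<Sum>i<length cs. cnt (drift f) (cs ! i))"
      using Shape.IH full by (intro sum.cong refl) auto
    also have "\<dots> = sum_list (map (cnt (drift f)) cs)"
      by (simp add: sum_list_sum_nth atLeast0LessThan)
    finally show ?thesis using False by (simp add: drift_def[of f "Shape k cs"] del: ssize.simps grow.simps)
  qed
qed

section \<open>Linearity of sums over nodes, and bounds on their increments\<close>

lemma cnt_cong:
  assumes "wf_shape t" "\<And>s. wf_shape s \<Longrightarrow> f s = g s"
  shows "cnt f t = cnt g t"
  using assms(1)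
proof (induction t)
  case (Shape k cs)
  then have "\<forall>c\<in>set cs. wf_shape c" by (auto split: if_splits)
  then have "map (cnt f) cs = map (cnt g) cs" using Shape.IH by auto
  then show ?case using assms(2) Shape.prems by (simp del: wf_shape.simps map_eq_conv)
qed

lemma cnt_add: "cnt (\<lambda>s. f s + g s) t = cnt f t + cnt g t"
proof (induction t)
  case (Shape k cs)
  then have "map (cnt (\<lambda>s. f s + g s)) cs = map (\<lambda>c. cnt f c + cnt g c) cs" by auto
  then show ?case by (simp add: sum_list_addf del: map_eq_conv)
qed

lemma cnt_scale: "cnt (\<lambda>s. a * f s) t = a * cnt f t"
proof (induction t)
  case (Shape k cs)
  then have "map (cnt (\<lambda>s. a * f s)) cs = map (\<lambda>c. a * cnt f c) cs" by auto
  then show ?case by (simp add: sum_list_const_mult algebra_simps del: map_eq_conv)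
qed

lemma cnt_zero: "cnt (\<lambda>s. 0) t = 0"
  using cnt_scale[of 0 "\<lambda>s. 0" t] by simp

lemma cnt_sum: "cnt (\<lambda>s. \<Sum>i\<in>A. f i s) t = (\<Sum>i\<in>A. cnt (f i) t)"
  by (induction A rule: infinite_finite_induct) (simp_all add: cnt_zero cnt_add)

text \<open>The new key passes at most \<open>ssize t + 1\<close> nodes, since sizes strictly
  decrease on the way down, and \<open>f\<close> changes by at most 1 at each of them; the
  \<open>m\<close> pays for newly created empty children.\<close>

lemma cnt_grow_diff_crude:
  assumes "wf_shape t" "r \<le> ssize t" "\<And>s. f s \<in> {0..1}"
  shows "\<bar>cnt f (grow r t) - cnt f t\<bar> \<le> ssize t + 1 + m"
  using assms(1,2)
proof (induction t arbitrary: r)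
  case (Shape k cs)
  have f01: "\<bar>f s - f s'\<bar> \<le> 1" for s s' using assms(3)[of s] assms(3)[of s'] by auto
  show ?case
  proof (cases "k < m - 1")
    case True
    have "0 \<le> real m * f (Shape 0 [])" "real m * f (Shape 0 []) \<le> m * 1"
      using assms(3)[of "Shape 0 []"] by (auto intro!: mult_left_le)
    then show ?thesis using Shape.prems True f01[of "Shape (Suc k) []" "Shape k []"]
        f01[of "Shape (Suc k) (replicate m (Shape 0 []))" "Shape k []"]
      by (auto simp: sum_list_replicate map_replicate_const)
  next
    case False
    note full = wf_shape_full[OF Shape.prems(1) False]
    have "r < gaps cs" using Shape.prems(2) full(4) by linarith
    then obtain i r' where i: "i < length cs" "r' \<le> ssize (cs ! i)"
      "grow_child r cs = cs[i := grow r' (cs ! i)]" by (rule grow_child_cases)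
    have "\<bar>cnt f (grow r' (cs ! i)) - cnt f (cs ! i)\<bar> \<le> ssize (cs ! i) + 1 + m"
      using Shape.IH[of "cs ! i" r'] i full by auto
    moreover have "ssize (cs ! i) + 1 \<le> ssize (Shape k cs)"
      using i full m_ge_2 member_le_sum_list[of "ssize (cs!i)" "map ssize cs"] by auto
    ultimately show ?thesis using False i f01[of "Shape k (cs[i := grow r' (cs ! i)])" "Shape k cs"]
      by (simp add: sum_list_map_update_diff del: ssize.simps)
  qed
qed

text \<open>By \<open>unchanged\<close>, \<open>f\<close> at a node does not notice the growth of a
  child with at least \<open>B\<close> keys. So nothing changes on the way down until a child with
  fewer than \<open>B\<close> keys is entered, and from there the crude bound is uniform.\<close>

lemma cnt_grow_diff_bounded:
  assumes "wf_shape t" "r \<le> ssize t" "\<And>s. f s \<in> {0..1}"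
    and unchanged: "\<And>k cs i r. \<lbrakk>wf_shape (Shape k cs); k = m - 1; i < m; B \<le> ssize (cs ! i);
        r \<le> ssize (cs ! i)\<rbrakk> \<Longrightarrow> f (Shape k (cs[i := grow r (cs ! i)])) = f (Shape k cs)"
  shows "\<bar>cnt f (grow r t) - cnt f t\<bar> \<le> B + 2 * m + 2"
  using assms(1,2)
proof (induction t arbitrary: r)
  case (Shape k cs)
  have f01: "\<bar>f s - f s'\<bar> \<le> 1" for s s' using assms(3)[of s] assms(3)[of s'] by auto
  show ?case
  proof (cases "k < m - 1")
    case True
    then have "cs = []" using Shape.prems by simp
    \<comment> \<open>The descent may also end in a node with room before reaching a small child;
      such a node has fewer than \<open>m\<close> keys, whence the summand
      \<open>2 * m\<close>.\<close>
    then show ?thesis using cnt_grow_diff_crude[of "Shape k cs" r f] Shape.prems assms(3) True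
      by (simp del: cnt.simps grow.simps)
  next
    case False
    note full = wf_shape_full[OF Shape.prems(1) False]
    have "r < gaps cs" using Shape.prems(2) full(4) by linarith
    then obtain i r' where i: "i < length cs" "r' \<le> ssize (cs ! i)"
      "grow_child r cs = cs[i := grow r' (cs ! i)]" by (rule grow_child_cases)
    have IH: "\<bar>cnt f (grow r' (cs ! i)) - cnt f (cs ! i)\<bar> \<le> B + 2 * m + 2"
      using Shape.IH[of "cs ! i" r'] i full by auto
    show ?thesis
    proof (cases "B \<le> ssize (cs ! i)")
      case True
      then have "f (Shape k (cs[i := grow r' (cs ! i)])) = f (Shape k cs)"
        using unchanged Shape.prems full i by auto
      then show ?thesis using False i IH by (simp add: sum_list_map_update_diff)
    next
      case 2: False
      have "wf_shape (cs ! i)" using full i by auto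
      then have "\<bar>cnt f (grow r' (cs ! i)) - cnt f (cs ! i)\<bar> \<le> ssize (cs ! i) + 1 + m"
        using i assms(3) by (intro cnt_grow_diff_crude)
      then show ?thesis using False 2 i f01[of "Shape k (cs[i := grow r' (cs ! i)])" "Shape k cs"]
        by (simp add: sum_list_map_update_diff)
    qed
  qed
qed

end

section \<open>Concentration from drift equations\<close>

text \<open>Mean value theorem; the derivative is nondecreasing because
  \<open>\<beta> \<ge> 1\<close>.\<close>

lemma powr_Suc_ge:
  fixes \<beta> :: real
  assumes "1 \<le> \<beta>"
  shows "(real n + 1) powr \<beta> + \<beta> * (real n + 1) powr (\<beta> - 1) \<le> (real (Suc n) + 1) powr \<beta>"
proof -
  have "((\<lambda>x. x powr \<beta>) has_real_derivative \<beta> * x powr (\<beta> - 1)) (at x)" if "x > 0" for x :: real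
    using that by (auto intro!: derivative_eq_intros)
  then obtain z where z: "real n + 1 < z" "z < real n + 2"
    "(real n + 2) powr \<beta> - (real n + 1) powr \<beta> = (real n + 2 - (real n + 1)) * (\<beta> * z powr (\<beta> - 1))"
    using MVT2[of "real n + 1" "real n + 2" "\<lambda>x. x powr \<beta>" "\<lambda>x. \<beta> * x powr (\<beta> - 1)"] by force
  moreover have "(real n + 1) powr (\<beta> - 1) \<le> z powr (\<beta> - 1)"
    using z assms by (intro powr_mono2) auto
  then have "\<beta> * (real n + 1) powr (\<beta> - 1) \<le> \<beta> * z powr (\<beta> - 1)"
    using assms by (intro mult_left_mono) auto
  ultimately show ?thesis by (simp add: add.commute)
qed

text \<open>A discrete Gronwall inequality: the homogeneous recursion grows only like
  \<open>n powr \<gamma>\<close>, so the accumulated forcing determines the order.\<close>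

lemma powr_growth:
  fixes y :: "nat \<Rightarrow> real"
  assumes step: "\<And>n. y (Suc n) \<le> (1 + \<gamma> / (real n + 1)) * y n + C * (real n + 1) powr (\<beta> - 1)"
    and "0 \<le> \<gamma>" "\<gamma> < \<beta>" "1 \<le> \<beta>"
  shows "\<exists>A. \<forall>n. y n \<le> A * (real n + 1) powr \<beta>"
proof -
  \<comment> \<open>The first entry starts the induction. The second gives
    \<open>C \<le> A * (\<beta> - \<gamma>)\<close>, so that the increment of the bound, with
    coefficient \<open>A * \<beta>\<close>, absorbs \<open>A * \<gamma> + C\<close>.\<close>
  define A where "A = max (y 0) (\<bar>C\<bar> / (\<beta> - \<gamma>))"
  have "\<bar>C\<bar> / (\<beta> - \<gamma>) \<le> A" unfolding A_def by simp
  then have A: "C \<le> A * (\<beta> - \<gamma>)"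
    using assms by (simp add: field_simps)
  have A0: "A \<ge> 0"
    using assms unfolding A_def by (simp add: le_max_iff_disj)
  have "y n \<le> A * (real n + 1) powr \<beta>" for n
  proof (induction n)
    case 0
    show ?case by (simp add: A_def)
  next
    case (Suc n)
    let ?x = "real n + 1"
    have e: "?x powr \<beta> = ?x * ?x powr (\<beta> - 1)"
      by (simp add: powr_diff)
    have "y (Suc n) \<le> (1 + \<gamma> / ?x) * (A * ?x powr \<beta>) + C * ?x powr (\<beta> - 1)"
      using Suc assms(2) by (intro order.trans[OF step] add_right_mono mult_left_mono) auto
    also have "\<dots> = A * ?x powr \<beta> + (A * \<gamma> + C) * ?x powr (\<beta> - 1)"
      unfolding e by (simp add: divide_simps) (simp add: algebra_simps)
    also have "\<dots> \<le> A * ?x powr \<beta> + (A * \<beta>) * ?x powr (\<beta> - 1)"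
      using A by (intro add_left_mono mult_right_mono) (auto simp: algebra_simps)
    also have "\<dots> = A * (?x powr \<beta> + \<beta> * ?x powr (\<beta> - 1))"
      by (simp add: algebra_simps)
    also have "\<dots> \<le> A * (real (Suc n) + 1) powr \<beta>"
      using A0 assms by (intro mult_left_mono powr_Suc_ge) auto
    finally show ?case .
  qed
  then show ?thesis by blast
qed

text \<open>A vanishing weighted mean forces \<open>x\<close> to be zero or of the opposite sign to
  \<open>x k\<close> at some \<open>l\<close>. Hence \<open>\<bar>x k\<bar>\<close> is at most the
  total variation of \<open>x\<close>, and Cauchy-Schwarz over the \<open>N\<close> steps gives the
  squares.\<close>

lemma discrete_poincare:
  fixes x w :: "nat \<Rightarrow> real"
  assumes w: "\<And>k. k \<le> N \<Longrightarrow> w k > 0" and sum0: "(\<Sum>k\<le>N. w k * x k) = 0" and k: "k \<le> N"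
  shows "(x k)\<^sup>2 \<le> real N * (\<Sum>j<N. (x (Suc j) - x j)\<^sup>2)"
proof -
  define T where "T = (\<Sum>j<N. \<bar>x (Suc j) - x j\<bar>)"
  have diff: "\<bar>x b - x a\<bar> \<le> T" if "a \<le> b" "b \<le> N" for a b
  proof -
    have "\<bar>x b - x a\<bar> = \<bar>\<Sum>j = a..<b. x (Suc j) - x j\<bar>"
      using that by (simp add: sum_Suc_diff')
    also have "\<dots> \<le> (\<Sum>j = a..<b. \<bar>x (Suc j) - x j\<bar>)" by (rule sum_abs)
    also have "\<dots> \<le> T" unfolding T_def using that by (intro sum_mono2) auto
    finally show ?thesis .
  qed
  have d: "\<bar>x b - x a\<bar> \<le> T" if "a \<le> N" "b \<le> N" for a b
    using diff[of a b] diff[of b a] that by (cases "a \<le> b") (auto simp: abs_minus_commute)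
  obtain l where l: "l \<le> N" "x k * x l \<le> 0"
  proof (rule ccontr)
    assume "\<not> thesis"
    then have pos: "x k * x l > 0" if "l \<le> N" for l
      using that \<open>(\<And>l. \<lbrakk>l \<le> N; x k * x l \<le> 0\<rbrakk> \<Longrightarrow> thesis)\<close> by fastforce
    have "0 < (\<Sum>l\<le>N. w l * (x k * x l))"
      using pos w by (intro sum_pos) auto
    also have "\<dots> = x k * (\<Sum>l\<le>N. w l * x l)"
      by (simp add: sum_distrib_left algebra_simps)
    finally show False using sum0 by simp
  qed
  have "(x k)\<^sup>2 \<le> (x k - x l)\<^sup>2"
    using l(2) by (simp add: power2_diff mult.assoc) (smt (verit) zero_le_power2)
  also have "\<dots> \<le> T\<^sup>2"
    using d[of l k] l k abs_le_square_iff[of "x k - x l" T] by (smt (verit))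
  also have "\<dots> \<le> real N * (\<Sum>j<N. (x (Suc j) - x j)\<^sup>2)"
    unfolding T_def using sum_squared_le_sum_of_squares[of "\<lambda>j. \<bar>x (Suc j) - x j\<bar>" "{..<N}"]
    by (simp add: mult.commute)
  finally show ?thesis .
qed

context mary
begin

text \<open>The expectation of a functional of the random tree on \<open>n\<close> keys, of which each
  of the \<open>n + 1\<close> gaps is equally likely to receive the next key.\<close>
primrec expect :: "nat \<Rightarrow> (shape \<Rightarrow> real) \<Rightarrow> real" where
  "expect 0 F = F (Shape 0 [])"
| "expect (Suc n) F = expect n (\<lambda>s. (\<Sum>r\<le>n. F (grow r s)) / (real n + 1))"

lemma expect_mono:
  assumes "\<And>s. wf_shape s \<Longrightarrow> ssize s = n \<Longrightarrow> F s \<le> G s"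
  shows "expect n F \<le> expect n G"
  using assms
proof (induction n arbitrary: F G)
  case 0
  then show ?case using m_ge_2 by simp
next
  case (Suc n)
  show ?case unfolding expect.simps
    by (intro Suc.IH divide_right_mono sum_mono Suc.prems) (auto simp: wf_shape_grow ssize_grow)
qed

lemma expect_cong:
  assumes "\<And>s. wf_shape s \<Longrightarrow> ssize s = n \<Longrightarrow> F s = G s"
  shows "expect n F = expect n G"
  using assms by (intro antisym expect_mono) auto

lemma expect_add: "expect n (\<lambda>s. F s + G s) = expect n F + expect n G"
  by (induction n arbitrary: F G) (simp_all add: sum.distrib add_divide_distrib)

lemma expect_scale: "expect n (\<lambda>s. a * F s) = a * expect n F"
proof (induction n arbitrary: F)
  case (Suc n)
  have "(\<lambda>s. (\<Sum>r\<le>n. a * F (grow r s)) / (real n + 1)) = (\<lambda>s. a * ((\<Sum>r\<le>n. F (grow r s)) / (real n + 1)))"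
    by (simp add: sum_distrib_left)
  then show ?case by (simp only: expect.simps Suc.IH)
qed simp

lemma expect_const: "expect n (\<lambda>s. a) = a"
proof (induction n)
  case (Suc n)
  have "(\<Sum>r\<le>n. a) / (real n + 1) = a" by (simp add: field_simps)
  then show ?case using Suc by simp
qed simp

lemma expect_sum: "finite A \<Longrightarrow> expect n (\<lambda>s. \<Sum>i\<in>A. F i s) = (\<Sum>i\<in>A. expect n (F i))"
  by (induction A rule: finite_induct) (simp_all add: expect_const expect_add)

section \<open>Bounded increments and second moments\<close>

definition lipschitz :: "(shape \<Rightarrow> real) \<Rightarrow> bool" where
  "lipschitz Z \<longleftrightarrow> (\<exists>K\<ge>0. \<forall>s r. wf_shape s \<longrightarrow> r \<le> ssize s \<longrightarrow> \<bar>Z (grow r s) - Z s\<bar> \<le> K)"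

text \<open>The center is a multiple of the number of gaps rather than of keys: since the next gap
  is chosen among just that many, drift identities stay exact after centering.\<close>

definition concentrates :: "real \<Rightarrow> (shape \<Rightarrow> real) \<Rightarrow> real \<Rightarrow> bool" where
  "concentrates \<beta> Z z \<longleftrightarrow>
    (\<exists>C. \<forall>n. expect n (\<lambda>s. (Z s - z * (real (ssize s) + 1))\<^sup>2) \<le> C * (real n + 1) powr \<beta>)"

lemma lipschitz_scale:
  assumes "lipschitz Z"
  shows "lipschitz (\<lambda>s. a * Z s)"
proof -
  obtain K where "K \<ge> 0" "\<And>s r. wf_shape s \<Longrightarrow> r \<le> ssize s \<Longrightarrow> \<bar>Z (grow r s) - Z s\<bar> \<le> K"
    using assms unfolding lipschitz_def by blast
  then show ?thesis unfolding lipschitz_def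
    by (intro exI[of _ "\<bar>a\<bar> * K"]) (auto simp: right_diff_distrib[symmetric] abs_mult intro!: mult_left_mono)
qed

lemma lipschitz_add:
  assumes "lipschitz Y" "lipschitz Z"
  shows "lipschitz (\<lambda>s. Y s + Z s)"
proof -
  obtain K where "K \<ge> 0" "\<And>s r. wf_shape s \<Longrightarrow> r \<le> ssize s \<Longrightarrow> \<bar>Y (grow r s) - Y s\<bar> \<le> K"
    using assms unfolding lipschitz_def by blast
  moreover obtain L where "L \<ge> 0" "\<And>s r. wf_shape s \<Longrightarrow> r \<le> ssize s \<Longrightarrow> \<bar>Z (grow r s) - Z s\<bar> \<le> L"
    using assms unfolding lipschitz_def by blast
  ultimately show ?thesis unfolding lipschitz_def
    by (intro exI[of _ "K + L"]) (smt (verit))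
qed

lemma lipschitz_zero: "lipschitz (\<lambda>s. 0)"
  unfolding lipschitz_def by (rule exI[of _ 0]) simp

lemma lipschitz_sum: "(\<And>i. i \<in> A \<Longrightarrow> lipschitz (Z i)) \<Longrightarrow> lipschitz (\<lambda>s. \<Sum>i\<in>A. Z i s)"
  by (induction A rule: infinite_finite_induct) (auto simp: lipschitz_zero lipschitz_add)

lemma lipschitz_centered:
  assumes "lipschitz Z"
  shows "lipschitz (\<lambda>s. Z s - z * (real (ssize s) + 1))"
proof -
  have "lipschitz (\<lambda>s. real (ssize s) + 1)"
    unfolding lipschitz_def by (intro exI[of _ 1]) (auto simp: ssize_grow)
  from lipschitz_add[OF assms lipschitz_scale[OF this, of "- z"]] show ?thesis by simp
qed

lemma concentrates_cong:
  assumes "\<And>s. wf_shape s \<Longrightarrow> Y s = Z s"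
  shows "concentrates \<beta> Y y = concentrates \<beta> Z y"
proof -
  have "expect n (\<lambda>s. (Y s - y * (real (ssize s) + 1))\<^sup>2) = expect n (\<lambda>s. (Z s - y * (real (ssize s) + 1))\<^sup>2)" for n
    using assms by (intro expect_cong) auto
  then show ?thesis unfolding concentrates_def by simp
qed

lemma concentrates_scale:
  assumes "concentrates \<beta> Z z"
  shows "concentrates \<beta> (\<lambda>s. a * Z s) (a * z)"
proof -
  obtain C where C: "\<And>n. expect n (\<lambda>s. (Z s - z * (real (ssize s) + 1))\<^sup>2) \<le> C * (real n + 1) powr \<beta>"
    using assms unfolding concentrates_def by blast
  have eq: "(\<lambda>s. (a * Z s - a * z * (real (ssize s) + 1))\<^sup>2) = (\<lambda>s. a\<^sup>2 * (Z s - z * (real (ssize s) + 1))\<^sup>2)"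
    by (simp add: power_mult_distrib[symmetric] algebra_simps)
  show ?thesis unfolding concentrates_def eq expect_scale
    using C by (intro exI[of _ "a\<^sup>2 * C"]) (auto simp: mult.assoc intro!: mult_left_mono)
qed

lemma concentrates_add:
  assumes "concentrates \<beta> Y y" "concentrates \<beta> Z z"
  shows "concentrates \<beta> (\<lambda>s. Y s + Z s) (y + z)"
proof -
  let ?Y = "\<lambda>s. Y s - y * (real (ssize s) + 1)" and ?Z = "\<lambda>s. Z s - z * (real (ssize s) + 1)"
  obtain C where C: "\<And>n. expect n (\<lambda>s. (?Y s)\<^sup>2) \<le> C * (real n + 1) powr \<beta>"
    using assms unfolding concentrates_def by blast
  obtain D where D: "\<And>n. expect n (\<lambda>s. (?Z s)\<^sup>2) \<le> D * (real n + 1) powr \<beta>"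
    using assms unfolding concentrates_def by blast
  have sq: "(a + b)\<^sup>2 \<le> 2 * a\<^sup>2 + 2 * b\<^sup>2" for a b :: real
    using zero_le_power2[of "a - b"] by (simp add: power2_sum power2_diff)
  have "expect n (\<lambda>s. (Y s + Z s - (y + z) * (real (ssize s) + 1))\<^sup>2) \<le> (2 * C + 2 * D) * (real n + 1) powr \<beta>" for n
  proof -
    have "(Y s + Z s - (y + z) * (real (ssize s) + 1))\<^sup>2 \<le> 2 * (?Y s)\<^sup>2 + 2 * (?Z s)\<^sup>2" for s
      using sq[of "?Y s" "?Z s"] by (simp add: algebra_simps)
    then have "expect n (\<lambda>s. (Y s + Z s - (y + z) * (real (ssize s) + 1))\<^sup>2) \<le> expect n (\<lambda>s. 2 * (?Y s)\<^sup>2 + 2 * (?Z s)\<^sup>2)"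
      by (intro expect_mono)
    also have "\<dots> \<le> (2 * C + 2 * D) * (real n + 1) powr \<beta>"
      unfolding expect_add expect_scale using C[of n] D[of n] by (simp add: algebra_simps)
    finally show ?thesis .
  qed
  then show ?thesis unfolding concentrates_def by blast
qed

lemma concentrates_zero: "concentrates \<beta> (\<lambda>s. 0) 0"
  unfolding concentrates_def by (intro exI[of _ 0]) (simp add: expect_const)

lemma concentrates_sum:
  "(\<And>i. i \<in> A \<Longrightarrow> concentrates \<beta> (Z i) (z i)) \<Longrightarrow> concentrates \<beta> (\<lambda>s. \<Sum>i\<in>A. Z i s) (\<Sum>i\<in>A. z i)"
  by (induction A rule: infinite_finite_induct) (auto simp: concentrates_zero concentrates_add)

text \<open>Expand the square of \<open>V s\<close> plus its increment and average over the
  \<open>n + 1\<close> gaps: the cross term is the drift times \<open>2 * V s\<close>, and the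
  squared increment is bounded.\<close>

lemma second_moment_step:
  assumes "lipschitz V"
    and drift: "\<And>s. wf_shape s \<Longrightarrow> (\<Sum>r\<le>ssize s. V (grow r s) - V s) = D s"
  shows "\<exists>K\<ge>0. \<forall>n. expect (Suc n) (\<lambda>s. (V s)\<^sup>2) \<le>
    expect n (\<lambda>s. (V s)\<^sup>2) + 2 / (real n + 1) * expect n (\<lambda>s. V s * D s) + K"
proof -
  obtain K where K: "\<And>s r. wf_shape s \<Longrightarrow> r \<le> ssize s \<Longrightarrow> \<bar>V (grow r s) - V s\<bar> \<le> K"
    using assms unfolding lipschitz_def by blast
  have eq: "x * (a + c) + 2 * d = (a + (2 / x * d + c)) * x" if "x > 0" for x a c d :: real
    using that by (simp add: field_simps)
  have "expect (Suc n) (\<lambda>s. (V s)\<^sup>2) \<le>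
    expect n (\<lambda>s. (V s)\<^sup>2) + 2 / (real n + 1) * expect n (\<lambda>s. V s * D s) + K\<^sup>2" for n
  proof -
    have "expect (Suc n) (\<lambda>s. (V s)\<^sup>2) \<le> expect n (\<lambda>s. (V s)\<^sup>2 + (2 / (real n + 1) * (V s * D s) + K\<^sup>2))"
      unfolding expect.simps
    proof (rule expect_mono)
      fix s assume s: "wf_shape s" "ssize s = n"
      have "(V (grow r s))\<^sup>2 \<le> (V s)\<^sup>2 + 2 * V s * (V (grow r s) - V s) + K\<^sup>2" if "r \<le> n" for r
      proof -
        have "(V (grow r s) - V s)\<^sup>2 \<le> K\<^sup>2"
          using K[OF s(1), of r] that s(2) abs_le_square_iff[of "V (grow r s) - V s" K] by auto
        then show ?thesis by (simp add: power2_eq_square algebra_simps)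
      qed
      then have "(\<Sum>r\<le>n. (V (grow r s))\<^sup>2) \<le> (\<Sum>r\<le>n. (V s)\<^sup>2 + 2 * V s * (V (grow r s) - V s) + K\<^sup>2)"
        by (intro sum_mono) auto
      also have "\<dots> = (real n + 1) * ((V s)\<^sup>2 + K\<^sup>2) + 2 * V s * (\<Sum>r\<le>n. V (grow r s) - V s)"
        unfolding sum.distrib sum_distrib_left[symmetric] by (simp add: algebra_simps)
      also have "(\<Sum>r\<le>n. V (grow r s) - V s) = D s" using drift[OF s(1)] s(2) by simp
      also have "(real n + 1) * ((V s)\<^sup>2 + K\<^sup>2) + 2 * V s * D s =
          ((V s)\<^sup>2 + (2 / (real n + 1) * (V s * D s) + K\<^sup>2)) * (real n + 1)"
        using eq[of "real n + 1" "(V s)\<^sup>2" "K\<^sup>2" "V s * D s"] by (simp add: mult.assoc)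
      finally show "(\<Sum>r\<le>n. (V (grow r s))\<^sup>2) / (real n + 1) \<le> (V s)\<^sup>2 + (2 / (real n + 1) * (V s * D s) + K\<^sup>2)"
        by (simp only: pos_divide_le_eq[of "real n + 1"] of_nat_0_le_iff add_nonneg_pos zero_less_one)
    qed
    then show ?thesis by (simp only: expect_add expect_scale expect_const add.assoc)
  qed
  then show ?thesis by (intro exI[of _ "K\<^sup>2"]) auto
qed

lemma sum_drift_centered:
  assumes "wf_shape s"
  shows "(\<Sum>r\<le>ssize s. (Z (grow r s) - z * (real (ssize (grow r s)) + 1)) - (Z s - z * (real (ssize s) + 1)))
    = (\<Sum>r\<le>ssize s. Z (grow r s) - Z s) - z * (real (ssize s) + 1)"
proof -
  have "(\<Sum>r\<le>ssize s. (Z (grow r s) - z * (real (ssize (grow r s)) + 1)) - (Z s - z * (real (ssize s) + 1)))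
    = (\<Sum>r\<le>ssize s. (Z (grow r s) - Z s) - z)"
    using assms by (intro sum.cong refl) (simp add: ssize_grow algebra_simps)
  then show ?thesis by (simp add: sum_subtractf algebra_simps)
qed

text \<open>The drift pulls \<open>Z\<close> towards the solution \<open>z\<close> of \<open>z = y - b * z\<close>.\<close>
lemma concentrates_driven:
  assumes "lipschitz Z" "1 < \<beta>" "0 \<le> b"
    and drift: "\<And>s. wf_shape s \<Longrightarrow> (\<Sum>r\<le>ssize s. Z (grow r s) - Z s) = Y s - b * Z s"
    and Y: "concentrates \<beta> Y y"
  shows "concentrates \<beta> Z (y / (1 + b))"
proof -
  define z where "z = y / (1 + b)"
  have "z * (1 + b) = y" using assms(3) by (simp add: z_def)
  \<comment> \<open>Of the center of \<open>Y\<close>, the part \<open>b * z\<close> cancels against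
    the center of \<open>b * Z\<close>, and the part \<open>z\<close> against the growth of the
    center of \<open>Z\<close>; the drift of \<open>V\<close> is then
    \<open>R - b * V\<close>.\<close>
  then have z: "y = z + b * z" by (simp add: algebra_simps)
  define R where "R = (\<lambda>s. Y s - y * (real (ssize s) + 1))"
  define V where "V = (\<lambda>s. Z s - z * (real (ssize s) + 1))"
  obtain C where C: "\<And>n. expect n (\<lambda>s. (R s)\<^sup>2) \<le> C * (real n + 1) powr \<beta>"
    using Y unfolding concentrates_def R_def by blast
  have "lipschitz V" unfolding V_def by (rule lipschitz_centered[OF assms(1)])
  moreover have "(\<Sum>r\<le>ssize s. V (grow r s) - V s) = R s - b * V s" if "wf_shape s" for s
    unfolding V_def sum_drift_centered[OF that] drift[OF that] R_def z by (simp add: algebra_simps)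
  ultimately obtain K where K: "K \<ge> 0" "\<And>n. expect (Suc n) (\<lambda>s. (V s)\<^sup>2) \<le>
    expect n (\<lambda>s. (V s)\<^sup>2) + 2 / (real n + 1) * expect n (\<lambda>s. V s * (R s - b * V s)) + K"
    using second_moment_step[of V "\<lambda>s. R s - b * V s"] by blast
  have eq: "2 / x * (1/2 * a + 1/2 * (C * c)) = a / x + C * (c / x)" if "x > 0" for x a c :: real
    using that by (simp add: field_simps)
  have "expect (Suc n) (\<lambda>s. (V s)\<^sup>2) \<le> (1 + 1 / (real n + 1)) * expect n (\<lambda>s. (V s)\<^sup>2) +
    (C + K) * (real n + 1) powr (\<beta> - 1)" for n
  proof -
    let ?x = "real n + 1"
    \<comment> \<open>The restoring term has the right sign and is dropped. Splitting
      \<open>V s * R s\<close> evenly leaves the homogeneous growth exponent 1, which is admissible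
      because \<open>\<beta> > 1\<close>.\<close>
    have "expect n (\<lambda>s. V s * (R s - b * V s)) \<le> expect n (\<lambda>s. 1/2 * (V s)\<^sup>2 + 1/2 * (R s)\<^sup>2)"
    proof (rule expect_mono)
      fix s
      have "V s * (R s - b * V s) \<le> V s * R s"
        using assms(3) by (simp add: algebra_simps)
      also have "\<dots> \<le> 1/2 * (V s)\<^sup>2 + 1/2 * (R s)\<^sup>2"
        using sum_squares_bound[of "V s" "R s"] by simp
      finally show "V s * (R s - b * V s) \<le> 1/2 * (V s)\<^sup>2 + 1/2 * (R s)\<^sup>2" .
    qed
    also have "\<dots> \<le> 1/2 * expect n (\<lambda>s. (V s)\<^sup>2) + 1/2 * (C * ?x powr \<beta>)"
      unfolding expect_add expect_scale using C[of n] by simp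
    finally have "2 / ?x * expect n (\<lambda>s. V s * (R s - b * V s)) \<le>
       2 / ?x * (1/2 * expect n (\<lambda>s. (V s)\<^sup>2) + 1/2 * (C * ?x powr \<beta>))"
      by (intro mult_left_mono) auto
    also have "\<dots> = expect n (\<lambda>s. (V s)\<^sup>2) / ?x + C * ?x powr (\<beta> - 1)"
      using eq[of ?x "expect n (\<lambda>s. (V s)\<^sup>2)" "?x powr \<beta>"] by (simp add: powr_diff)
    finally have 1: "2 / ?x * expect n (\<lambda>s. V s * (R s - b * V s)) \<le>
        expect n (\<lambda>s. (V s)\<^sup>2) / ?x + C * ?x powr (\<beta> - 1)" .
    have "K * 1 \<le> K * ?x powr (\<beta> - 1)"
      using K(1) assms(2) by (intro mult_left_mono) (auto intro!: ge_one_powr_ge_zero)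
    then show ?thesis using K(2)[of n] 1 by (simp add: algebra_simps)
  qed
  then obtain A where "\<And>n. expect n (\<lambda>s. (V s)\<^sup>2) \<le> A * (real n + 1) powr \<beta>"
    using powr_growth[of "\<lambda>n. expect n (\<lambda>s. (V s)\<^sup>2)" 1 "C + K" \<beta>] assms(2) by auto
  then show ?thesis unfolding concentrates_def V_def z_def by blast
qed

section \<open>Subtree sizes\<close>

definition size_count :: "nat \<Rightarrow> shape \<Rightarrow> real" where
  "size_count j = cnt (\<lambda>t. of_bool (ssize t = j))"

lemma lipschitz_cnt:
  assumes "\<And>s. f s \<in> {0..1}"
    and "\<And>k cs i r. \<lbrakk>wf_shape (Shape k cs); k = m - 1; i < m; B \<le> ssize (cs ! i);
        r \<le> ssize (cs ! i)\<rbrakk> \<Longrightarrow> f (Shape k (cs[i := grow r (cs ! i)])) = f (Shape k cs)"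
  shows "lipschitz (cnt f)"
  unfolding lipschitz_def
  using cnt_grow_diff_bounded[OF _ _ assms, of _ _ B] by (intro exI[of _ "real (B + 2 * m + 2)"]) auto

lemma ssize_child_update:
  assumes "wf_shape (Shape k cs)" "k = m - 1" "i < m" "r \<le> ssize (cs ! i)"
  shows "ssize (Shape k (cs[i := grow r (cs ! i)])) = Suc (ssize (Shape k cs))"
    "ssize (cs ! i) < ssize (Shape k cs)"
proof -
  note full = wf_shape_full[OF assms(1)]
  have "wf_shape (cs ! i)" "length cs = m" using assms full by auto
  then show "ssize (Shape k (cs[i := grow r (cs ! i)])) = Suc (ssize (Shape k cs))"
    using assms by (simp add: sum_list_map_update_Suc ssize_grow)
  show "ssize (cs ! i) < ssize (Shape k cs)"
    using \<open>length cs = m\<close> assms m_ge_2 member_le_sum_list[of "ssize (cs!i)" "map ssize cs"] by auto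
qed

lemma lipschitz_cnt_size:
  assumes "\<And>j. f j \<in> {0..1}" "\<And>j. B \<le> j \<Longrightarrow> f (Suc j) = f j"
  shows "lipschitz (cnt (\<lambda>t. f (ssize t)))"
proof (rule lipschitz_cnt[where B = B])
  fix k cs i r
  assume *: "wf_shape (Shape k cs)" "k = m - 1" "i < m" "B \<le> ssize (cs ! i)" "r \<le> ssize (cs ! i)"
  \<comment> \<open>The node has more keys than its child, hence at least \<open>B\<close>, where
    \<open>f\<close> is already constant.\<close>
  then have "f (Suc (ssize (Shape k cs))) = f (ssize (Shape k cs))"
    using ssize_child_update(2)[of k cs i r] by (intro assms(2)) linarith
  then show "f (ssize (Shape k (cs[i := grow r (cs ! i)]))) = f (ssize (Shape k cs))"
    using * by (simp only: ssize_child_update(1))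
qed (use assms in auto)

lemma wf_shape_almost_full:
  assumes "wf_shape (Shape k cs)"
  shows "Suc k = m - 1 \<longleftrightarrow> ssize (Shape k cs) = m - 2"
  using assms m_ge_2 by (cases "k < m - 1") auto

lemma drift_size:
  assumes "wf_shape t"
  shows "drift (\<lambda>t. f (ssize t)) t = (real (ssize t) + 1) * (f (Suc (ssize t)) - f (ssize t))
    + real ((m - 1) * m) * f 0 * of_bool (ssize t = m - 2)"
proof -
  have "(\<Sum>r\<le>ssize t. f (ssize (grow r t)) - f (ssize t)) = (\<Sum>r\<le>ssize t. f (Suc (ssize t)) - f (ssize t))"
    using assms by (intro sum.cong refl) (simp add: ssize_grow)
  moreover obtain k cs where "t = Shape k cs" by (cases t)
  ultimately show ?thesis using assms wf_shape_almost_full[of k cs]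
    by (simp add: drift_def del: ssize.simps wf_shape.simps) simp
qed

lemma lipschitz_size_count: "lipschitz (size_count j)"
  unfolding size_count_def by (rule lipschitz_cnt_size[where B = "Suc j"]) auto

text \<open>A subtree with \<open>j\<close> keys is left through its \<open>j + 1\<close> gaps, and
  one with \<open>j - 1\<close> keys turns into it through \<open>j\<close> gaps. Empty nodes arise
  differently: each of the \<open>m - 1\<close> gaps of a node with \<open>m - 2\<close> keys
  creates \<open>m\<close> of them.\<close>

lemma drift_size_count:
  assumes "wf_shape t"
  shows "(\<Sum>r\<le>ssize t. size_count j (grow r t) - size_count j t) =
    (if j = 0 then real ((m - 1) * m) * size_count (m - 2) t else real j * size_count (j - 1) t) - (real j + 1) * size_count j t"
proof -
  have "(\<Sum>r\<le>ssize t. size_count j (grow r t) - size_count j t) = cnt (drift (\<lambda>t. of_bool (ssize t = j))) t"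
    unfolding size_count_def using assms by (rule sum_cnt_grow)
  also have "\<dots> = cnt (\<lambda>t. (if j = 0 then real ((m - 1) * m) else real j) *
     of_bool (ssize t = (if j = 0 then m - 2 else j - 1)) + (- (real j + 1)) * of_bool (ssize t = j)) t"
    by (rule cnt_cong[OF assms]) (subst drift_size, auto simp: algebra_simps of_bool_def)
  also have "\<dots> = (if j = 0 then real ((m - 1) * m) * size_count (m - 2) t else real j * size_count (j - 1) t) - (real j + 1) * size_count j t"
    unfolding cnt_add cnt_scale size_count_def by (simp add: algebra_simps)
  finally show ?thesis .
qed

text \<open>Every gap belongs to exactly one node with room, and such a node with \<open>j\<close>
  keys owns \<open>j + 1\<close> gaps. This conservation law fixes the level
  \<open>size_const\<close> of the equilibrium and supplies the vanishing mean for
  \<open>discrete_poincare\<close>.\<close>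

lemma sum_size_count:
  assumes "wf_shape t"
  shows "(\<Sum>j\<le>m-2. (real j + 1) * size_count j t) = real (ssize t) + 1"
proof -
  have "(\<Sum>j\<le>m-2. (real j + 1) * size_count j t) = cnt (\<lambda>t. \<Sum>j\<le>m-2. (real j + 1) * of_bool (ssize t = j)) t"
    by (simp only: size_count_def cnt_sum cnt_scale)
  also have "(\<lambda>t. \<Sum>j\<le>m-2. (real j + 1) * of_bool (ssize t = j)) =
      (\<lambda>t. (real (ssize t) + 1) * of_bool (ssize t \<le> m - 2))"
    by (rule ext) (auto simp: of_bool_def if_distrib cong: if_cong)
  also have "cnt \<dots> t = real (ssize t) + 1"
    using assms
  proof (induction t)
    case (Shape k cs)
    show ?case
    proof (cases "k < m - 1")
      case True
      then show ?thesis using Shape.prems by auto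
    next
      case False
      note full = wf_shape_full[OF Shape.prems(1) False]
      have "map (cnt (\<lambda>t. (real (ssize t) + 1) * of_bool (ssize t \<le> m - 2))) cs = map (\<lambda>c. real (Suc (ssize c))) cs"
        using Shape.IH full by auto
      then have "sum_list (map (cnt (\<lambda>t. (real (ssize t) + 1) * of_bool (ssize t \<le> m - 2))) cs) = real (gaps cs)"
        by (simp only:) (simp add: sum_list_addf o_def flip: sum_list_of_nat)
      also have "\<dots> = real (ssize (Shape k cs)) + 1" using full(4) by linarith
      finally show ?thesis using full(1) m_ge_2 by simp
    qed
  qed
  finally show ?thesis .
qed

text \<open>At equilibrium \<open>size_count k\<close> is proportional to
  \<open>1 / ((k + 1) * (k + 2))\<close>; the scaling gives all \<open>k\<close> the same
  limit.\<close>

definition scaled_count :: "nat \<Rightarrow> shape \<Rightarrow> real" where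
  "scaled_count k s = (real k + 1) * (real k + 2) * size_count k s"

text \<open>The level that \<open>sum_size_count\<close> forces on the limits
  \<open>size_const / ((k + 1) * (k + 2))\<close> of \<open>size_count k\<close> per gap. It equals
  \<open>1 / (H - 1)\<close> with \<open>H\<close> the \<open>m\<close>-th harmonic number.\<close>

definition size_const :: real where
  "size_const = 1 / (\<Sum>k\<le>m-2. 1 / (real k + 2))"

definition cpred :: "nat \<Rightarrow> nat" where
  "cpred k = (if k = 0 then m - 2 else k - 1)"

lemma sum_cpred:
  fixes g :: "nat \<Rightarrow> 'b::comm_monoid_add"
  shows "(\<Sum>k\<le>m-2. g (cpred k)) = (\<Sum>k\<le>m-2. g k)"
proof (cases "m - 2")
  case (Suc N)
  have "(\<Sum>k\<le>Suc N. g (cpred k)) = g (cpred 0) + (\<Sum>k\<le>N. g (cpred (Suc k)))"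
    by (rule sum.atMost_Suc_shift)
  then show ?thesis using Suc by (simp add: cpred_def add.commute)
qed (simp add: cpred_def)

text \<open>The factor \<open>(m - 1) * m\<close> with which filled nodes create empty ones is the
  scaling factor of \<open>size_count (m - 2)\<close>, so \<open>k = 0\<close> is no exception: the
  cycle has no distinguished edge in this scaling.\<close>

lemma drift_scaled_count:
  assumes "wf_shape t"
  shows "(\<Sum>r\<le>ssize t. scaled_count k (grow r t) - scaled_count k t) = (real k + 2) * scaled_count (cpred k) t - (real k + 1) * scaled_count k t"
proof -
  have "(\<Sum>r\<le>ssize t. scaled_count k (grow r t) - scaled_count k t) = (real k + 1) * (real k + 2) * (\<Sum>r\<le>ssize t. size_count k (grow r t) - size_count k t)"
    by (simp add: scaled_count_def sum_distrib_left right_diff_distrib)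
  also have "\<dots> = (real k + 2) * scaled_count (cpred k) t - (real k + 1) * scaled_count k t"
    using m_ge_2 unfolding drift_size_count[OF assms] scaled_count_def cpred_def by (auto simp: algebra_simps of_nat_diff)
  finally show ?thesis .
qed

lemma size_const_pos: "size_const > 0"
  unfolding size_const_def by (auto intro!: divide_pos_pos sum_pos)

text \<open>The numbers of nodes with \<open>k \<le> m - 2\<close> keys drive each other in a cycle, because filling a node
  creates empty ones. In the scaling below, the squared deviations \<open>Psi\<close> from equilibrium decay at a rate
  given by the Dirichlet form of the cycle, which \<open>discrete_poincare\<close> bounds from below.\<close>
lemma concentrates_scaled_count: "\<exists>\<beta>>1. \<beta> < 2 \<and> (\<forall>k\<le>m-2. concentrates \<beta> (scaled_count k) size_const)"
proof -
  define N where "N = m - 2"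
  define M where "M = real N + 1"
  define V where "V = (\<lambda>k s. scaled_count k s - size_const * (real (ssize s) + 1))"
  \<comment> \<open>Dividing by \<open>k + 2\<close> gives the coupling
    \<open>V k * V (cpred k)\<close> in \<open>V k * D k\<close> the coefficient 1 for every
    \<open>k\<close>, so that it can be completed to squares around the cycle. The relation
    \<open>V0\<close> has the same weights.\<close>
  define Psi where "Psi = (\<lambda>s. \<Sum>k\<le>N. (V k s)\<^sup>2 / (real k + 2))"
  define D where "D = (\<lambda>k s. (real k + 2) * V (cpred k) s - (real k + 1) * V k s)"
  define E where "E = (\<lambda>s. \<Sum>k\<le>N. V k s * D k s / (real k + 2))"
  have hsum: "(\<Sum>k\<le>N. 1 / (real k + 2)) * size_const = 1"
    using size_const_pos by (simp add: size_const_def N_def)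
  have lip: "lipschitz (V k)" for k
    unfolding V_def scaled_count_def by (intro lipschitz_centered lipschitz_scale lipschitz_size_count)
  have driftV: "(\<Sum>r\<le>ssize s. V k (grow r s) - V k s) = D k s" if "wf_shape s" for k s
    unfolding V_def sum_drift_centered[OF that] drift_scaled_count[OF that] D_def by (simp add: algebra_simps)
  have V0: "(\<Sum>k\<le>N. 1 / (real k + 2) * V k s) = 0" if "wf_shape s" for s
  proof -
    have "1 / (real k + 2) * V k s = (real k + 1) * size_count k s - (1 / (real k + 2)) * size_const * (real (ssize s) + 1)" for k
      unfolding V_def scaled_count_def by (simp add: field_simps)
    then have "(\<Sum>k\<le>N. 1 / (real k + 2) * V k s) =
       (\<Sum>k\<le>N. (real k + 1) * size_count k s) - (\<Sum>k\<le>N. 1 / (real k + 2)) * size_const * (real (ssize s) + 1)"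
      by (simp only: sum_subtractf sum_distrib_right)
    then show ?thesis using sum_size_count[OF that] by (simp add: hsum flip: N_def)
  qed
  have M1: "M \<ge> 1" by (simp add: M_def)
  have dissip: "E s \<le> (1 - 1 / M\<^sup>2) * Psi s" if "wf_shape s" for s
  proof -
    define Q where "Q = (\<Sum>k\<le>N. (V k s - V (cpred k) s)\<^sup>2)"
    \<comment> \<open>Polarization of \<open>V k * V (cpred k)\<close>, with
      \<open>1 - (k + 1) / (k + 2) = 1 / (k + 2)\<close>. The last two terms cancel in the sum,
      because \<open>cpred\<close> permutes the indices.\<close>
    have "V k s * D k s / (real k + 2) = (V k s)\<^sup>2 / (real k + 2) - 1/2 * (V k s - V (cpred k) s)\<^sup>2
       + 1/2 * (V (cpred k) s)\<^sup>2 - 1/2 * (V k s)\<^sup>2" for k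
      unfolding D_def by (simp add: field_simps power2_eq_square)
    then have "E s = Psi s - 1/2 * Q + 1/2 * (\<Sum>k\<le>N. (V (cpred k) s)\<^sup>2) - 1/2 * (\<Sum>k\<le>N. (V k s)\<^sup>2)"
      unfolding E_def Psi_def Q_def by (simp only: sum_subtractf sum.distrib sum_distrib_left)
    also have "(\<Sum>k\<le>N. (V (cpred k) s)\<^sup>2) = (\<Sum>k\<le>N. (V k s)\<^sup>2)"
      unfolding N_def by (rule sum_cpred)
    finally have E: "E s = Psi s - 1/2 * Q" by simp
    \<comment> \<open>The edge from \<open>N\<close> back to 0 can be given up: the Poincare
      inequality already holds on the path.\<close>
    have Q: "(\<Sum>j<N. (V (Suc j) s - V j s)\<^sup>2) \<le> Q"
    proof -
      have "Q = (V 0 s - V N s)\<^sup>2 + (\<Sum>j<N. (V (Suc j) s - V j s)\<^sup>2)"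
        unfolding Q_def lessThan_Suc_atMost[symmetric] sum.lessThan_Suc_shift
        by (simp add: cpred_def N_def)
      then show ?thesis by simp
    qed
    have Q0: "0 \<le> Q" unfolding Q_def by (intro sum_nonneg) auto
    \<comment> \<open>\<open>Psi\<close> has \<open>M\<close> summands of this size, which produces
      the factor \<open>M\<^sup>2\<close> of the contraction rate.\<close>
    have "(V k s)\<^sup>2 / (real k + 2) \<le> M * Q / 2" if k: "k \<le> N" for k
    proof -
      have "(V k s)\<^sup>2 \<le> real N * (\<Sum>j<N. (V (Suc j) s - V j s)\<^sup>2)"
        using V0[OF \<open>wf_shape s\<close>] k by (intro discrete_poincare[where w = "\<lambda>k. 1 / (real k + 2)"]) auto
      also have "\<dots> \<le> M * Q" using Q Q0 by (intro mult_mono) (auto simp: M_def intro!: sum_nonneg)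
      finally have "(V k s)\<^sup>2 / (real k + 2) \<le> M * Q / (real k + 2)" by (intro divide_right_mono) auto
      also have "\<dots> \<le> M * Q / 2" using Q0 M1 by (intro divide_left_mono) auto
      finally show ?thesis .
    qed
    then have "Psi s \<le> (\<Sum>k\<le>N. M * Q / 2)" unfolding Psi_def by (intro sum_mono) auto
    also have "\<dots> = M\<^sup>2 * (1/2 * Q)" by (simp add: M_def power2_eq_square)
    finally have "Psi s / M\<^sup>2 \<le> 1/2 * Q" using M1 by (simp add: field_simps)
    then show ?thesis unfolding E by (simp add: left_diff_distrib)
  qed
  have "\<forall>k. \<exists>K\<ge>0. \<forall>n. expect (Suc n) (\<lambda>s. (V k s)\<^sup>2) \<le>
    expect n (\<lambda>s. (V k s)\<^sup>2) + 2 / (real n + 1) * expect n (\<lambda>s. V k s * D k s) + K"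
    using second_moment_step[OF lip driftV] by blast
  then obtain K where K: "\<And>k. K k \<ge> 0" "\<And>k n. expect (Suc n) (\<lambda>s. (V k s)\<^sup>2) \<le>
    expect n (\<lambda>s. (V k s)\<^sup>2) + 2 / (real n + 1) * expect n (\<lambda>s. V k s * D k s) + K k"
    by metis
  define C where "C = (\<Sum>k\<le>N. K k)"
  have C0: "C \<ge> 0" unfolding C_def using K by (intro sum_nonneg) auto
  \<comment> \<open>\<open>\<gamma>\<close> is twice the factor in \<open>dissip\<close>, the 2
    coming from the cross term of the square; the gain \<open>1 / M\<^sup>2\<close> keeps it below
    2. The choice of \<open>\<beta>\<close> is some value above both \<open>\<gamma>\<close> and 1
    that is still below 2.\<close>
  define \<gamma> where "\<gamma> = 2 - 2 / M\<^sup>2"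
  define \<beta> where "\<beta> = 2 - 1 / (2 * M\<^sup>2)"
  have M2: "M\<^sup>2 \<ge> 1" using M1 by simp
  then have "1 / M\<^sup>2 \<le> 1" "1 / M\<^sup>2 > 0" by (auto simp: divide_simps)
  then have exps: "0 \<le> \<gamma>" "\<gamma> < \<beta>" "1 < \<beta>" "\<beta> < 2" unfolding \<gamma>_def \<beta>_def by (auto simp: divide_simps)
  have expPsi: "expect n Psi = (\<Sum>k\<le>N. expect n (\<lambda>s. (V k s)\<^sup>2) / (real k + 2))" for n
    unfolding Psi_def using expect_scale[of n "1 / (real _ + 2)"] by (simp add: expect_sum)
  have expE: "expect n E = (\<Sum>k\<le>N. expect n (\<lambda>s. V k s * D k s) / (real k + 2))" for n
    unfolding E_def using expect_scale[of n "1 / (real _ + 2)"] by (simp add: expect_sum)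
  have "expect (Suc n) Psi \<le> (1 + \<gamma> / (real n + 1)) * expect n Psi + C * (real n + 1) powr (\<beta> - 1)" for n
  proof -
    let ?x = "real n + 1"
    have "expect (Suc n) Psi \<le> (\<Sum>k\<le>N. (expect n (\<lambda>s. (V k s)\<^sup>2) + 2 / ?x * expect n (\<lambda>s. V k s * D k s) + K k) / (real k + 2))"
      unfolding expPsi by (intro sum_mono divide_right_mono K) auto
    also have "\<dots> = expect n Psi + 2 / ?x * expect n E + (\<Sum>k\<le>N. K k / (real k + 2))"
      unfolding expPsi expE by (simp add: add_divide_distrib sum.distrib sum_distrib_left)
    finally have 1: "expect (Suc n) Psi \<le> expect n Psi + 2 / ?x * expect n E + (\<Sum>k\<le>N. K k / (real k + 2))" .
    have "K k / (real k + 2) \<le> K k" for k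
      using mult_left_mono[of 1 "real k + 2" "K k"] K(1)[of k] by (simp add: divide_le_eq)
    then have "(\<Sum>k\<le>N. K k / (real k + 2)) \<le> C"
      unfolding C_def by (intro sum_mono)
    also have "C * 1 \<le> C * ?x powr (\<beta> - 1)"
      using exps C0 by (intro mult_left_mono ge_one_powr_ge_zero) auto
    finally have 2: "(\<Sum>k\<le>N. K k / (real k + 2)) \<le> C * ?x powr (\<beta> - 1)" by simp
    have "expect n E \<le> expect n (\<lambda>s. (1 - 1 / M\<^sup>2) * Psi s)"
      using dissip by (intro expect_mono)
    also have "\<dots> = \<gamma> / 2 * expect n Psi" unfolding expect_scale \<gamma>_def by simp
    finally have "2 / ?x * expect n E \<le> 2 / ?x * (\<gamma> / 2 * expect n Psi)" by (intro mult_left_mono) auto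
    also have "\<dots> = \<gamma> / ?x * expect n Psi" by (simp add: divide_simps)
    finally show ?thesis using 1 2 by (simp add: distrib_right)
  qed
  then obtain A where A: "\<And>n. expect n Psi \<le> A * (real n + 1) powr \<beta>"
    using powr_growth[of "\<lambda>n. expect n Psi" \<gamma> C \<beta>] exps by auto
  have "concentrates \<beta> (scaled_count k) size_const" if k: "k \<le> N" for k
    unfolding concentrates_def
  proof (intro exI allI)
    fix n
    have "(V k s)\<^sup>2 \<le> (real k + 2) * Psi s" for s
    proof -
      have "(V k s)\<^sup>2 / (real k + 2) \<le> Psi s" unfolding Psi_def
        using k by (intro member_le_sum) auto
      then show ?thesis by (simp add: field_simps)
    qed
    then have "expect n (\<lambda>s. (V k s)\<^sup>2) \<le> expect n (\<lambda>s. (real k + 2) * Psi s)"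
      by (intro expect_mono)
    also have "\<dots> \<le> (real k + 2) * (A * (real n + 1) powr \<beta>)"
      unfolding expect_scale using A[of n] by (intro mult_left_mono) auto
    finally show "expect n (\<lambda>s. (scaled_count k s - size_const * (real (ssize s) + 1))\<^sup>2) \<le> (real k + 2) * A * (real n + 1) powr \<beta>"
      unfolding V_def by (simp add: mult.assoc)
  qed
  then show ?thesis using exps unfolding N_def by blast
qed

end

section \<open>Profiles of children\<close>

text \<open>Groups the lists by their number \<open>l\<close> of zeros; the induction step is
  Pascal's rule applied to the head.\<close>

lemma sum_binary_lists:
  fixes g :: "nat \<Rightarrow> real" and a :: nat
  assumes "a \<noteq> 0"
  shows "(\<Sum>xs | set xs \<subseteq> {0, a} \<and> length xs = n. g (count_list xs 0)) =
    (\<Sum>l\<le>n. real (n choose l) * g l)"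
proof (induction n arbitrary: g)
  case 0
  have "{xs. set xs \<subseteq> {0, a} \<and> length xs = 0} = {[]}" by auto
  then show ?case by simp
next
  case (Suc n)
  let ?L = "\<lambda>n. {xs. set xs \<subseteq> {0, a} \<and> length xs = n}"
  have fin: "finite (?L n)" by (rule finite_lists_length_eq) simp
  have "?L (Suc n) = (#) 0 ` ?L n \<union> (#) a ` ?L n"
    by (auto simp: length_Suc_conv)
  moreover have "(#) 0 ` ?L n \<inter> (#) a ` ?L n = {}" using assms by auto
  ultimately have "(\<Sum>xs\<in>?L (Suc n). g (count_list xs 0)) =
     (\<Sum>xs\<in>(#) 0 ` ?L n. g (count_list xs 0)) + (\<Sum>xs\<in>(#) a ` ?L n. g (count_list xs 0))"
    using fin by (simp only: sum.union_disjoint finite_imageI)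
  also have "\<dots> = (\<Sum>xs\<in>?L n. g (Suc (count_list xs 0))) + (\<Sum>xs\<in>?L n. g (count_list xs 0))"
    using assms by (simp add: sum.reindex)
  also have "\<dots> = (\<Sum>l\<le>n. real (n choose l) * g (Suc l)) + (\<Sum>l\<le>n. real (n choose l) * g l)"
    using Suc.IH[of "\<lambda>l. g (Suc l)"] Suc.IH[of g] by simp
  also have "(\<Sum>l\<le>n. real (n choose l) * g l) = (\<Sum>l\<le>Suc n. real (n choose l) * g l)"
    by simp
  also have "(\<Sum>l\<le>n. real (n choose l) * g (Suc l)) + (\<Sum>l\<le>Suc n. real (n choose l) * g l) =
      (\<Sum>l\<le>Suc n. real (Suc n choose l) * g l)"
    unfolding sum.atMost_Suc_shift by (simp add: sum.distrib distrib_right)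
  finally show ?case .
qed

text \<open>Identifies the only profile from which growth of entry \<open>i\<close> leads to
  \<open>\<sigma>\<close>. The equation for \<open>\<sigma> ! i\<close> excludes 0, where the
  subtraction would be truncated.\<close>

lemma list_update_Suc_eq_iff:
  assumes "i < length p"
  shows "p[i := Suc (p ! i)] = \<sigma> \<longleftrightarrow> \<sigma> ! i = Suc (p ! i) \<and> p = \<sigma>[i := \<sigma> ! i - 1]"
proof
  assume "p[i := Suc (p ! i)] = \<sigma>"
  then have "\<sigma> = p[i := Suc (p ! i)]" ..
  then show "\<sigma> ! i = Suc (p ! i) \<and> p = \<sigma>[i := \<sigma> ! i - 1]" using assms by simp
next
  assume *: "\<sigma> ! i = Suc (p ! i) \<and> p = \<sigma>[i := \<sigma> ! i - 1]"
  define q where "q = p ! i"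
  have q1: "\<sigma> ! i = Suc q" using conjunct1[OF *] by (simp only: q_def)
  have q2: "p = \<sigma>[i := q]" using conjunct2[OF *] by (simp only: q1 diff_Suc_1)
  have "p[i := Suc q] = \<sigma>[i := \<sigma> ! i]"
    by (simp only: q2 q1 list_update_overwrite)
  then show "p[i := Suc (p ! i)] = \<sigma>" by (simp only: list_update_id flip: q_def)
qed

context mary
begin

abbreviation profile :: "shape list \<Rightarrow> nat list" where
  "profile cs \<equiv> map (\<lambda>c. min m (ssize c)) cs"

definition has_profile :: "nat list \<Rightarrow> shape \<Rightarrow> bool" where
  "has_profile \<sigma> t = (case t of Shape k cs \<Rightarrow> cs \<noteq> [] \<and> profile cs = \<sigma>)"

definition profile_count :: "nat list \<Rightarrow> shape \<Rightarrow> real" where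
  "profile_count \<sigma> = cnt (\<lambda>t. of_bool (has_profile \<sigma> t))"

lemma lipschitz_profile_count: "lipschitz (profile_count \<sigma>)"
  unfolding profile_count_def
proof (rule lipschitz_cnt[where B = m])
  fix k cs i r
  assume *: "wf_shape (Shape k cs)" "k = m - 1" "i < m" "m \<le> ssize (cs ! i)" "r \<le> ssize (cs ! i)"
  then have "length cs = m" "wf_shape (cs ! i)" using wf_shape_full[OF *(1)] by auto
  then have "profile (cs[i := grow r (cs ! i)]) = profile cs"
    using * by (auto simp: map_update ssize_grow intro!: nth_equalityI simp: nth_list_update)
  then show "of_bool (has_profile \<sigma> (Shape k (cs[i := grow r (cs ! i)]))) = of_bool (has_profile \<sigma> (Shape k cs))"
    by (simp add: has_profile_def)
qed auto

text \<open>A node enters profile \<open>\<sigma>\<close> through the \<open>\<sigma> ! i\<close>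
  gaps of a child that is one key short, and leaves it through the \<open>\<sigma> ! i + 1\<close>
  gaps of a child below the cap; growth of a capped child is invisible. A node first acquires a
  profile, that of all zeros, when one of its \<open>m - 1\<close> gaps is hit while it has
  \<open>m - 2\<close> keys.\<close>

lemma drift_profile:
  assumes t: "wf_shape t" and \<sigma>: "length \<sigma> = m" "\<And>i. i < m \<Longrightarrow> \<sigma> ! i \<le> m"
  shows "drift (\<lambda>t. of_bool (has_profile \<sigma> t)) t =
     (real (m - 1) * of_bool (\<sigma> = replicate m 0)) * of_bool (ssize t = m - 2)
     + (\<Sum>i<m. real (\<sigma> ! i) * of_bool (has_profile (\<sigma>[i := \<sigma> ! i - 1]) t))
     + - (\<Sum>i<m. of_bool (\<sigma> ! i < m) * (real (\<sigma> ! i) + 1)) * of_bool (has_profile \<sigma> t)"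
proof (cases t)
  case (Shape k cs)
  show ?thesis
  proof (cases "k < m - 1")
    case True
    then have "cs = []" using t Shape by simp
    moreover have "(real k + 1) = real (m - 1)" if "Suc k = m - 1"
      using that by linarith
    moreover have "replicate m (0::nat) = \<sigma> \<longleftrightarrow> \<sigma> = replicate m 0" by auto
    ultimately show ?thesis using True Shape m_ge_2
      by (auto simp: drift_def has_profile_def map_replicate_const)
  next
    case False
    note full = wf_shape_full[OF t[unfolded Shape] False]
    have [simp]: "cs \<noteq> []" using full m_ge_2 by auto
    have size: "{..ssize (Shape k cs)} = {..<gaps cs}" using full(4) by auto
    let ?f = "\<lambda>l. of_bool (profile l = \<sigma>) - of_bool (profile cs = \<sigma>) :: real"
    have "drift (\<lambda>t. of_bool (has_profile \<sigma> t)) t = (\<Sum>r<gaps cs. ?f (grow_child r cs))"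
    proof -
      have "grow_child r cs \<noteq> []" for r by (cases cs) auto
      then show ?thesis using False size unfolding Shape drift_def
        by (auto simp: has_profile_def simp del: ssize.simps)
    qed
    also have "\<dots> = (\<Sum>i<length cs. \<Sum>r\<le>ssize (cs ! i). ?f (cs[i := grow r (cs ! i)]))"
      by (rule sum_grow_child)
    also have "\<dots> = (\<Sum>i<m. (real (ssize (cs ! i)) + 1) *
       (of_bool ((profile cs)[i := min m (Suc (ssize (cs ! i)))] = \<sigma>) - of_bool (profile cs = \<sigma>)))"
    proof (intro sum.cong)
      fix i assume "i \<in> {..<m}"
      then have "?f (cs[i := grow r (cs ! i)]) = of_bool ((profile cs)[i := min m (Suc (ssize (cs ! i)))] = \<sigma>) - of_bool (profile cs = \<sigma>)"
        if "r \<le> ssize (cs ! i)" for r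
        using that full by (simp add: map_update ssize_grow)
      then show "(\<Sum>r\<le>ssize (cs ! i). ?f (cs[i := grow r (cs ! i)])) =
        (real (ssize (cs ! i)) + 1) *
       (of_bool ((profile cs)[i := min m (Suc (ssize (cs ! i)))] = \<sigma>) - of_bool (profile cs = \<sigma>))"
        by simp
    qed (use full in auto)
    also have "\<dots> = (\<Sum>i<m. real (\<sigma> ! i) * of_bool (profile cs = \<sigma>[i := \<sigma> ! i - 1])
        - of_bool (\<sigma> ! i < m) * (real (\<sigma> ! i) + 1) * of_bool (profile cs = \<sigma>))"
    proof (intro sum.cong refl)
      fix i assume "i \<in> {..<m}"
      then have i: "i < m" by simp
      let ?p = "profile cs" and ?s = "ssize (cs ! i)"
      have len: "length ?p = m" using full by simp
      have pi: "?p ! i = min m ?s" using i full by simp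
      show "(real ?s + 1) * (of_bool (?p[i := min m (Suc ?s)] = \<sigma>) - of_bool (?p = \<sigma>)) =
        real (\<sigma> ! i) * of_bool (?p = \<sigma>[i := \<sigma> ! i - 1])
        - of_bool (\<sigma> ! i < m) * (real (\<sigma> ! i) + 1) * of_bool (?p = \<sigma>)"
      proof (cases "?s < m")
        case True
        have ps: "?p ! i = ?s" using pi True by linarith
        have "i < length ?p" using len i by simp
        from list_update_Suc_eq_iff[OF this, of \<sigma>]
        have up: "?p[i := Suc ?s] = \<sigma> \<longleftrightarrow> \<sigma> ! i = Suc ?s \<and> ?p = \<sigma>[i := \<sigma> ! i - 1]"
          unfolding ps .
        have dn: "?p = \<sigma>[i := \<sigma> ! i - 1] \<Longrightarrow> \<sigma> ! i \<noteq> 0 \<Longrightarrow> \<sigma> ! i = Suc ?s"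
        proof -
          assume that: "?p = \<sigma>[i := \<sigma> ! i - 1]" "\<sigma> ! i \<noteq> 0"
          from that(1) have "?p ! i = \<sigma>[i := \<sigma> ! i - 1] ! i" by (rule arg_cong)
          also have "\<dots> = \<sigma> ! i - 1" using i \<sigma>(1) by simp
          finally show "\<sigma> ! i = Suc ?s" using pi True that(2) by linarith
        qed
        have eq: "?p = \<sigma> \<Longrightarrow> \<sigma> ! i = ?s" using pi True by auto
        \<comment> \<open>The claim without its lists: an identity in one size \<open>a\<close>, one
          entry \<open>x\<close> and two propositions.\<close>
        have "(real a + 1) * (of_bool (x = Suc a \<and> B) - of_bool A) =
            real x * of_bool B - of_bool (x < m) * (real x + 1) * of_bool A"
          if "B \<Longrightarrow> x \<noteq> 0 \<Longrightarrow> x = Suc a" "A \<Longrightarrow> x = a" "a < m" for a x A B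
          using that by (cases A; cases B; cases "x = 0") auto
        from this[OF dn eq True] show ?thesis
          unfolding min.absorb2[OF Suc_leI[OF True]] up .
      next
        case False
        \<comment> \<open>The child is at the cap, so its growth leaves the profile as it is. The
          profile cannot be the lowered one either, whose entry \<open>\<sigma> ! i - 1\<close> is
          below \<open>m\<close>.\<close>
        then have "min m (Suc ?s) = ?p ! i" using pi by simp
        moreover have "?p \<noteq> \<sigma>[i := \<sigma> ! i - 1]"
        proof
          assume "?p = \<sigma>[i := \<sigma> ! i - 1]"
          then have "?p ! i = \<sigma>[i := \<sigma> ! i - 1] ! i" by (rule arg_cong)
          also have "\<dots> = \<sigma> ! i - 1" using i \<sigma>(1) by simp
          finally show False using pi False \<sigma>(2)[OF i] m_ge_2 by linarith
        qed
        moreover have "?p = \<sigma> \<Longrightarrow> \<not> \<sigma> ! i < m" using pi False by auto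
        ultimately show ?thesis by auto
      qed
    qed
    also have "\<dots> = (\<Sum>i<m. real (\<sigma> ! i) * of_bool (has_profile (\<sigma>[i := \<sigma> ! i - 1]) t))
     + - (\<Sum>i<m. of_bool (\<sigma> ! i < m) * (real (\<sigma> ! i) + 1)) * of_bool (has_profile \<sigma> t)"
      by (simp add: sum_subtractf sum_distrib_right has_profile_def Shape)
    finally show ?thesis using Shape full m_ge_2 by auto
  qed
qed

lemma drift_profile_count:
  assumes t: "wf_shape t" and \<sigma>: "length \<sigma> = m" "\<And>i. i < m \<Longrightarrow> \<sigma> ! i \<le> m"
  shows "(\<Sum>r\<le>ssize t. profile_count \<sigma> (grow r t) - profile_count \<sigma> t) =
     (real (m - 1) * of_bool (\<sigma> = replicate m 0) * size_count (m - 2) t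
     + (\<Sum>i<m. real (\<sigma> ! i) * profile_count (\<sigma>[i := \<sigma> ! i - 1]) t))
     - (\<Sum>i<m. of_bool (\<sigma> ! i < m) * (real (\<sigma> ! i) + 1)) * profile_count \<sigma> t"
proof -
  have "(\<Sum>r\<le>ssize t. profile_count \<sigma> (grow r t) - profile_count \<sigma> t) = cnt (drift (\<lambda>t. of_bool (has_profile \<sigma> t))) t"
    unfolding profile_count_def using t by (rule sum_cnt_grow)
  also have "\<dots> = cnt (\<lambda>t. (real (m - 1) * of_bool (\<sigma> = replicate m 0)) * of_bool (ssize t = m - 2)
     + (\<Sum>i<m. real (\<sigma> ! i) * of_bool (has_profile (\<sigma>[i := \<sigma> ! i - 1]) t))
     + - (\<Sum>i<m. of_bool (\<sigma> ! i < m) * (real (\<sigma> ! i) + 1)) * of_bool (has_profile \<sigma> t)) t"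
    using \<sigma> by (intro cnt_cong[OF t] drift_profile)
  finally show ?thesis unfolding cnt_add cnt_sum cnt_scale profile_count_def size_count_def by simp
qed

definition small_count :: "nat list \<Rightarrow> nat" where
  "small_count \<sigma> = sum_list (map (\<lambda>x. of_bool (x < m)) \<sigma>)"

text \<open>Equals \<open>size_const / m * (\<integral>y\<in>{0..1}. (\<Prod>x\<leftarrow>\<sigma>. g x y))\<close> with \<open>g x y = (1 - y) * y ^ x\<close> for \<open>x < m\<close> and
  \<open>g m y = y ^ m\<close>: with \<open>y = 1 - exp (- t)\<close>, the factors are the probabilities that a child has
  \<open>x\<close> (for \<open>x = m\<close>: at least \<open>m\<close>) keys at time \<open>t\<close> when every gap receives keys at rate 1.\<close>
definition profile_density :: "nat list \<Rightarrow> real" where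
  "profile_density \<sigma> = size_const / m * (fact (sum_list \<sigma>) * fact (small_count \<sigma>) / fact (sum_list \<sigma> + small_count \<sigma> + 1))"

lemma small_count_update:
  assumes "i < length \<sigma>"
  shows "small_count (\<sigma>[i := x]) + of_bool (\<sigma> ! i < m) = small_count \<sigma> + of_bool (x < m)"
  unfolding small_count_def by (rule sum_list_map_update[OF assms, of "\<lambda>x. of_bool (x < m)" x])

text \<open>The fixed-point equation that \<open>concentrates_driven\<close> requires of the limits.
  Lowering an entry lowers the sum by 1, and if the entry was \<open>m\<close>, it also raises
  \<open>small_count\<close> by 1; either way the density changes by a rational factor, and these
  factors add up to 1 plus the total outflow.\<close>

lemma profile_density_recurrence:
  assumes \<sigma>: "length \<sigma> = m" "\<And>i. i < m \<Longrightarrow> \<sigma> ! i \<le> m"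
  shows "real (m - 1) * of_bool (\<sigma> = replicate m 0) * (1 / (real (m - 1) * real m) * size_const) +
     (\<Sum>i<m. real (\<sigma> ! i) * profile_density (\<sigma>[i := \<sigma> ! i - 1])) =
     profile_density \<sigma> * (1 + (\<Sum>i<m. of_bool (\<sigma> ! i < m) * (real (\<sigma> ! i) + 1)))"
proof -
  define s where "s = sum_list \<sigma>"
  define z where "z = small_count \<sigma>"
  define P where "P = (\<Sum>i<m. of_bool (\<sigma> ! i < m) * real (\<sigma> ! i))"
  have zsum: "real z = (\<Sum>i<m. of_bool (\<sigma> ! i < m))"
    using \<sigma> by (simp add: z_def small_count_def sum_list_sum_nth atLeast0LessThan flip: of_nat_sum)
  have ssum: "real s = (\<Sum>i<m. real (\<sigma> ! i))"
    using \<sigma> by (simp add: s_def sum_list_sum_nth atLeast0LessThan)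
  have b: "(\<Sum>i<m. of_bool (\<sigma> ! i < m) * (real (\<sigma> ! i) + 1)) = P + real z"
    unfolding zsum P_def by (simp only: sum.distrib[symmetric] distrib_left mult_1_right)
  show ?thesis
  proof (cases "s = 0")
    \<comment> \<open>For the zero profile all \<open>m\<close> entries are small, and both sides
      equal \<open>size_const / m\<close>.\<close>
    case True
    then have "\<forall>x\<in>set \<sigma>. x = 0" by (simp add: s_def)
    then have *: "\<sigma> = replicate m 0" using \<sigma> by (simp add: replicate_eqI)
    have "small_count (replicate m 0) = m" using m_ge_2 by (simp add: small_count_def map_replicate_const sum_list_replicate)
    moreover from this have "z = m" by (simp only: z_def *)
    moreover have "P = 0" unfolding P_def * by simp
    moreover have "real (m - 1) * (1 / (real (m - 1) * real m) * size_const) = size_const / m" using m_ge_2 by simp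
    ultimately show ?thesis using m_ge_2 True
      by (simp add: b profile_density_def * sum_list_replicate add.commute)
  next
    case False
    then obtain s' where s': "s = Suc s'" by (cases s) auto
    \<comment> \<open>\<open>G\<close> is \<open>profile_density \<sigma> / s\<close>. Lowering an
      entry below \<open>m\<close> gives \<open>G * (s + z + 1)\<close>, lowering an entry
      \<open>m\<close> gives \<open>G * (z + 1)\<close>.\<close>
    define G where "G = size_const / m * (fact s' * fact z / fact (s + z + 1))"
    have ne: "\<sigma> \<noteq> replicate m 0" using False by (auto simp: s_def sum_list_replicate)
    have summand: "real (\<sigma> ! i) * profile_density (\<sigma>[i := \<sigma> ! i - 1]) =
        G * ((real z + 1) * real (\<sigma> ! i) + real s * (of_bool (\<sigma> ! i < m) * real (\<sigma> ! i)))" if i: "i < m" for i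
    proof (cases "\<sigma> ! i = 0")
      case nz: False
      have sum': "sum_list (\<sigma>[i := \<sigma> ! i - 1]) = s'"
        using i \<sigma> nz s' elem_le_sum_list[of i \<sigma>] by (simp add: sum_list_update s_def)
      have ilen: "i < length \<sigma>" using i \<sigma> by simp
      show ?thesis
      proof (cases "\<sigma> ! i < m")
        case True
        then have "\<sigma> ! i - 1 < m" by linarith
        with True have "small_count (\<sigma>[i := \<sigma> ! i - 1]) = z"
          using small_count_update[OF ilen, of "\<sigma> ! i - 1"] by (simp add: z_def)
        then have "profile_density (\<sigma>[i := \<sigma> ! i - 1]) = size_const / m * (fact s' * fact z / fact (s' + z + 1))"
          unfolding profile_density_def sum' by simp
        also have "\<dots> = G * (real s + real z + 1)"
        proof -
          have "fact (s + z + 1) = real (s + z + 1) * fact (s' + z + 1)"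
            using fact_Suc[of "s' + z + 1", where 'a = real] by (simp only: s' add_Suc Suc_eq_plus1 add.assoc) (simp add: ac_simps)
          then have f: "fact (s + z + 1) = (real s + real z + 1) * fact (s' + z + 1)" by simp
          have "a * (b / c) = a * (b / (d * c)) * d" if "d > 0" for a b c d :: real
            using that by simp
          then show ?thesis unfolding G_def f by this linarith
        qed
        finally show ?thesis using True by (simp add: algebra_simps)
      next
        case nm: False
        then have "\<sigma> ! i = m" using \<sigma>(2)[OF i] by simp
        then have "small_count (\<sigma>[i := \<sigma> ! i - 1]) = z + 1"
          using small_count_update[OF ilen, of "\<sigma> ! i - 1"] m_ge_2 by (simp add: z_def)
        then have "profile_density (\<sigma>[i := \<sigma> ! i - 1]) = size_const / m * (fact s' * fact (z + 1) / fact (s' + (z + 1) + 1))"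
          unfolding profile_density_def sum' by simp
        also have "\<dots> = G * (real z + 1)"
          unfolding G_def s' by (simp add: field_simps)
        finally show ?thesis using nm by (simp add: algebra_simps)
      qed
    qed simp
    have "(\<Sum>i<m. real (\<sigma> ! i) * profile_density (\<sigma>[i := \<sigma> ! i - 1])) = G * ((real z + 1) * real s + real s * P)"
      using summand by (simp add: sum.distrib sum_distrib_left[symmetric] ssum P_def)
    also have "\<dots> = G * real s * (1 + (P + real z))" by (simp add: algebra_simps)
    also have "G * real s = profile_density \<sigma>" unfolding G_def profile_density_def s_def[symmetric] z_def[symmetric] s' by simp
    finally show ?thesis unfolding b using ne by simp
  qed
qed

text \<open>Induction on the sum of the profile: the lowered profiles have a smaller sum and form
  the input \<open>Y\<close> of \<open>concentrates_driven\<close>, while the zero profile is fed by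
  \<open>size_count (m - 2)\<close> alone.\<close>

lemma concentrates_profile_count:
  assumes "1 < \<beta>" and conc: "concentrates \<beta> (size_count (m - 2)) (1 / (real (m - 1) * real m) * size_const)"
    and "length \<sigma> = m" "\<And>i. i < m \<Longrightarrow> \<sigma> ! i \<le> m"
  shows "concentrates \<beta> (profile_count \<sigma>) (profile_density \<sigma>)"
  using assms(3,4)
proof (induction "sum_list \<sigma>" arbitrary: \<sigma> rule: less_induct)
  case less
  let ?b = "\<Sum>i<m. of_bool (\<sigma> ! i < m) * (real (\<sigma> ! i) + 1)"
  let ?y = "real (m - 1) * of_bool (\<sigma> = replicate m 0) * (1 / (real (m - 1) * real m) * size_const) +
     (\<Sum>i<m. real (\<sigma> ! i) * profile_density (\<sigma>[i := \<sigma> ! i - 1]))"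
  have b: "0 \<le> ?b" by (intro sum_nonneg) auto
  have "concentrates \<beta> (\<lambda>t. real (\<sigma> ! i) * profile_count (\<sigma>[i := \<sigma> ! i - 1]) t) (real (\<sigma> ! i) * profile_density (\<sigma>[i := \<sigma> ! i - 1]))"
    if i: "i < m" for i
  proof (cases "\<sigma> ! i = 0")
    \<comment> \<open>Here the lowered list is \<open>\<sigma>\<close> itself, out of reach of the
      induction hypothesis, but its coefficient is 0.\<close>
    case True
    then show ?thesis by (simp add: concentrates_zero)
  next
    case False
    have "sum_list (\<sigma>[i := \<sigma> ! i - 1]) < sum_list \<sigma>"
      using i less.prems(1) False elem_le_sum_list[of i \<sigma>] by (simp add: sum_list_update)
    moreover have "\<sigma>[i := \<sigma> ! i - 1] ! j \<le> m" if "j < m" for j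
      using that i less.prems(1) less.prems(2)[of i] less.prems(2)[of j] by (cases "j = i") auto
    ultimately show ?thesis
      using less.prems by (intro concentrates_scale less.hyps) auto
  qed
  then have "concentrates \<beta> (\<lambda>t. real (m - 1) * of_bool (\<sigma> = replicate m 0) * size_count (m - 2) t
     + (\<Sum>i<m. real (\<sigma> ! i) * profile_count (\<sigma>[i := \<sigma> ! i - 1]) t)) ?y"
    by (intro concentrates_add[OF concentrates_scale[OF conc]] concentrates_sum) auto
  from concentrates_driven[OF lipschitz_profile_count assms(1) b drift_profile_count this]
  have "concentrates \<beta> (profile_count \<sigma>) (?y / (1 + ?b))" using less.prems by auto
  moreover have "?y / (1 + ?b) = profile_density \<sigma>"
  proof -
    have "?y = profile_density \<sigma> * (1 + ?b)" by (rule profile_density_recurrence) (use less.prems in auto)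
    moreover have "1 + ?b \<noteq> 0" using b by linarith
    ultimately show ?thesis by (rule iffD2[OF nonzero_divide_eq_eq, rotated])
  qed
  ultimately show ?case by (simp only:)
qed

section \<open>Nodes, 2-protected nodes and the value of the limit\<close>

definition node_count :: "shape \<Rightarrow> real" where
  "node_count = cnt (\<lambda>t. of_bool (1 \<le> ssize t))"

text \<open>A node is not a leaf iff its subtree has at least \<open>m\<close> keys, as its own
  \<open>m - 1\<close> keys leave all children empty. Children of size 0 are deleted in the end and
  cannot be leaves.\<close>

definition is_protected :: "shape \<Rightarrow> bool" where
  "is_protected t = (case t of Shape k cs \<Rightarrow> m \<le> ssize t \<and> (\<forall>c\<in>set cs. ssize c = 0 \<or> m \<le> ssize c))"

definition protected_count :: "shape \<Rightarrow> real" where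
  "protected_count = cnt (\<lambda>t. of_bool (is_protected t))"

lemma lipschitz_node_count: "lipschitz node_count"
  unfolding node_count_def by (rule lipschitz_cnt_size[where B = 1]) auto

text \<open>A node enters the count when an empty one receives its first key, and then stays. The
  summand with 0 fits \<open>concentrates_driven\<close> with \<open>b = 0\<close>.\<close>

lemma drift_node_count:
  assumes "wf_shape t"
  shows "(\<Sum>r\<le>ssize t. node_count (grow r t) - node_count t) = size_count 0 t - 0 * node_count t"
proof -
  have "(\<Sum>r\<le>ssize t. node_count (grow r t) - node_count t) = cnt (drift (\<lambda>t. of_bool (1 \<le> ssize t))) t"
    unfolding node_count_def using assms by (rule sum_cnt_grow)
  also have "\<dots> = size_count 0 t"
    unfolding size_count_def by (rule cnt_cong[OF assms]) (subst drift_size, auto simp: of_bool_def)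
  finally show ?thesis by simp
qed

text \<open>The zero profile belongs to full nodes with only empty children, which are
  leaves.\<close>

definition protected_profiles :: "nat list set" where
  "protected_profiles = {\<sigma>. set \<sigma> \<subseteq> {0, m} \<and> length \<sigma> = m} - {replicate m 0}"

lemma finite_protected_profiles: "finite protected_profiles"
  unfolding protected_profiles_def by (intro finite_Diff finite_lists_length_eq) simp

lemma protected_count_eq:
  assumes "wf_shape t"
  shows "protected_count t = (\<Sum>\<sigma>\<in>protected_profiles. profile_count \<sigma> t)"
proof -
  have "of_bool (is_protected s) = (\<Sum>\<sigma>\<in>protected_profiles. of_bool (has_profile \<sigma> s) :: real)"
    if s: "wf_shape s" for s
  proof (cases s)
    case (Shape k cs)
    show ?thesis
    proof (cases "k < m - 1")
      case True
      then show ?thesis using s Shape by (auto simp: is_protected_def has_profile_def)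
    next
      case False
      note full = wf_shape_full[OF s[unfolded Shape] False]
      have ne: "cs \<noteq> []" using full m_ge_2 by auto
      have "is_protected s \<longleftrightarrow> profile cs \<in> protected_profiles"
      proof -
        have 1: "(\<forall>c\<in>set cs. ssize c = 0 \<or> m \<le> ssize c) \<longleftrightarrow> set (profile cs) \<subseteq> {0, m}"
          using m_ge_2 by (auto simp: min_def)
        have "m \<le> ssize (Shape k cs) \<longleftrightarrow> sum_list (map ssize cs) \<noteq> 0"
        proof -
          have "ssize (Shape k cs) = (m - 1) + sum_list (map ssize cs)" using full(1) by simp
          then show ?thesis using m_ge_2 by linarith
        qed
        also have "\<dots> \<longleftrightarrow> (\<exists>c\<in>set cs. ssize c \<noteq> 0)" by auto
        also have "\<dots> \<longleftrightarrow> profile cs \<noteq> replicate m 0"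
        proof -
          have "profile cs = replicate m 0 \<longleftrightarrow> (\<forall>x\<in>set (profile cs). x = 0)"
            using full(2) by (metis in_set_replicate length_map replicate_eqI)
          moreover have "(\<forall>x\<in>set (profile cs). x = 0) \<longleftrightarrow> (\<forall>c\<in>set cs. ssize c = 0)"
          proof -
            have "min m x = 0 \<longleftrightarrow> x = 0" for x using m_ge_2 by (auto simp: min_def)
            then show ?thesis by simp
          qed
          ultimately have "profile cs = replicate m 0 \<longleftrightarrow> (\<forall>c\<in>set cs. ssize c = 0)" by (rule trans)
          then show ?thesis by (simp only:) simp
        qed
        finally have "m \<le> ssize (Shape k cs) \<longleftrightarrow> profile cs \<noteq> replicate m 0" .
        then show ?thesis using 1 full(2) Shape unfolding is_protected_def protected_profiles_def
          by (simp add: conj_commute del: ssize.simps)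
      qed
      moreover have "(\<Sum>\<sigma>\<in>protected_profiles. of_bool (has_profile \<sigma> s) :: real) =
          (\<Sum>\<sigma>\<in>protected_profiles. if profile cs = \<sigma> then 1 else 0)"
        using ne Shape by (intro sum.cong) (auto simp: has_profile_def)
      ultimately show ?thesis using finite_protected_profiles by (simp add: sum.delta)
    qed
  qed
  then have "protected_count t = cnt (\<lambda>s. \<Sum>\<sigma>\<in>protected_profiles. of_bool (has_profile \<sigma> s)) t"
    unfolding protected_count_def by (intro cnt_cong[OF assms])
  then show ?thesis by (simp only: cnt_sum profile_count_def)
qed

text \<open>A profile with \<open>l\<close> zeros has \<open>small_count\<close> equal to
  \<open>l\<close> and sum \<open>m * (m - l)\<close>. There are \<open>m choose l\<close> of them,
  and the \<open>fact l\<close> in the density turns the binomial into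
  \<open>fact m / fact (m - l)\<close>. The excluded zero profile is the term
  \<open>l = m\<close>.\<close>

lemma sum_profile_density_protected:
  "(\<Sum>\<sigma>\<in>protected_profiles. profile_density \<sigma>) =
    size_const / m * (\<Sum>l = 0..m - 1. fact m / fact (m - l) * (fact (m * (m - l)) / fact (m * (m - l) + l + 1)))"
proof -
  let ?L = "{\<sigma>. set \<sigma> \<subseteq> {0, m} \<and> length \<sigma> = m}"
  define g :: "nat \<Rightarrow> real" where
    "g l = size_const / m * (fact (m * (m - l)) * fact l / fact (m * (m - l) + l + 1))" for l
  have fin: "finite ?L" by (rule finite_lists_length_eq) simp
  have limit: "profile_density \<sigma> = g (count_list \<sigma> 0)" if "\<sigma> \<in> ?L" for \<sigma>
  proof -
    have "set \<sigma> \<subseteq> {0, m} \<Longrightarrow> small_count \<sigma> = count_list \<sigma> 0 \<and> sum_list \<sigma> = m * (length \<sigma> - count_list \<sigma> 0)" for \<sigma>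
    proof (induction \<sigma>)
      case (Cons x \<sigma>)
      have "count_list \<sigma> 0 \<le> length \<sigma>" by (rule count_le_length)
      then show ?case using Cons m_ge_2 by (auto simp: small_count_def Suc_diff_le)
    qed (simp add: small_count_def)
    then show ?thesis using that by (simp add: profile_density_def g_def)
  qed
  have "replicate m 0 \<in> ?L" by auto
  then have "(\<Sum>\<sigma>\<in>protected_profiles. profile_density \<sigma>) = (\<Sum>\<sigma>\<in>?L. profile_density \<sigma>) - profile_density (replicate m 0)"
    unfolding protected_profiles_def using fin by (simp add: sum_diff1)
  also have "profile_density (replicate m 0) = g m"
  proof -
    have "count_list (replicate n (0::nat)) 0 = n" for n by (induction n) auto
    then show ?thesis using limit[of "replicate m 0"] \<open>replicate m 0 \<in> ?L\<close> by simp
  qed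
  also have "(\<Sum>\<sigma>\<in>?L. profile_density \<sigma>) = (\<Sum>\<sigma>\<in>?L. g (count_list \<sigma> 0))"
    using limit by (intro sum.cong) auto
  also have "\<dots> = (\<Sum>l\<le>m. real (m choose l) * g l)"
    using m_ge_2 by (intro sum_binary_lists) auto
  also have "\<dots> - g m = (\<Sum>l = 0..m - 1. real (m choose l) * g l)"
  proof -
    have "{..m} = insert m {0..m - 1}" using m_ge_2 by auto
    then show ?thesis using m_ge_2 by (simp add: atLeast0AtMost)
  qed
  also have "\<dots> = (\<Sum>l = 0..m - 1. size_const / m * (fact m / fact (m - l) * (fact (m * (m - l)) / fact (m * (m - l) + l + 1))))"
    by (intro sum.cong refl) (simp add: g_def binomial_fact mult.commute mult.left_commute)
  finally show ?thesis by (simp add: sum_distrib_left)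
qed

lemma concentrates_counts:
  "\<exists>\<beta><2. concentrates \<beta> node_count (size_const / 2) \<and>
    concentrates \<beta> protected_count (\<Sum>\<sigma>\<in>protected_profiles. profile_density \<sigma>)"
proof -
  obtain \<beta> where \<beta>: "1 < \<beta>" "\<beta> < 2" "\<And>k. k \<le> m - 2 \<Longrightarrow> concentrates \<beta> (scaled_count k) size_const"
    using concentrates_scaled_count by blast
  have sizes: "concentrates \<beta> (size_count k) (1 / ((real k + 1) * (real k + 2)) * size_const)" if "k \<le> m - 2" for k
  proof -
    have "(\<lambda>s. 1 / ((real k + 1) * (real k + 2)) * scaled_count k s) = size_count k"
      by (rule ext) (simp add: scaled_count_def)
    then show ?thesis using concentrates_scale[OF \<beta>(3)[OF that], of "1 / ((real k + 1) * (real k + 2))"] by simp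
  qed
  have "concentrates \<beta> node_count (size_const / 2 / (1 + 0))"
    using concentrates_driven[OF lipschitz_node_count \<beta>(1) order.refl drift_node_count, of "size_const / 2"] sizes[of 0] by simp
  moreover have "real (m - 2) + 1 = real (m - 1)" "real (m - 2) + 2 = real m" using m_ge_2 by auto
  then have "concentrates \<beta> (size_count (m - 2)) (1 / (real (m - 1) * real m) * size_const)" using sizes[of "m - 2"] by simp
  then have "concentrates \<beta> (\<lambda>t. \<Sum>\<sigma>\<in>protected_profiles. profile_count \<sigma> t) (\<Sum>\<sigma>\<in>protected_profiles. profile_density \<sigma>)"
    using \<beta>(1) by (intro concentrates_sum concentrates_profile_count)
      (auto simp: protected_profiles_def subset_iff dest: nth_mem)
  then have "concentrates \<beta> protected_count (\<Sum>\<sigma>\<in>protected_profiles. profile_density \<sigma>)"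
    by (subst concentrates_cong[of _ "\<lambda>t. \<Sum>\<sigma>\<in>protected_profiles. profile_count \<sigma> t"]) (simp_all add: protected_count_eq)
  ultimately show ?thesis using \<beta>(2) by auto
qed

lemma lipschitz_protected_count: "lipschitz protected_count"
proof -
  have "lipschitz (\<lambda>t. \<Sum>\<sigma>\<in>protected_profiles. profile_count \<sigma> t)" by (intro lipschitz_sum lipschitz_profile_count)
  then show ?thesis unfolding lipschitz_def by (simp add: protected_count_eq wf_shape_grow)
qed

end

section \<open>Search trees and their shapes\<close>

fun shape_of :: "mtree \<Rightarrow> shape" where
  "shape_of (Node K cs) = Shape (card K) (map shape_of cs)"

fun all_keys :: "mtree \<Rightarrow> real set" where
  "all_keys (Node K cs) = K \<union> (\<Union>c\<in>set cs. all_keys c)"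

lemma subtree_at_append:
  "subtree_at t (v @ w) = Option.bind (subtree_at t v) (\<lambda>s. subtree_at s w)"
  by (induction t v rule: subtree_at.induct) auto

text \<open>Turns cardinalities of address sets into \<open>cnt\<close>: addresses through different
  children differ in their head.\<close>

lemma card_positions:
  "finite {v. \<exists>s. subtree_at t v = Some s \<and> q (shape_of s)} \<and>
   real (card {v. \<exists>s. subtree_at t v = Some s \<and> q (shape_of s)}) = cnt (\<lambda>s. of_bool (q s)) (shape_of t)"
proof (induction t)
  case (Node K cs)
  let ?P = "\<lambda>t. {v. \<exists>s. subtree_at t v = Some s \<and> q (shape_of s)}"
  let ?R = "if q (shape_of (Node K cs)) then {[] :: nat list} else {}"
  let ?C = "\<Union>i<length cs. (#) i ` ?P (cs ! i)"
  have IH: "finite (?P (cs ! i))" "real (card (?P (cs ! i))) = cnt (\<lambda>s. of_bool (q s)) (shape_of (cs ! i))"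
    if "i < length cs" for i
    using Node.IH[of "cs ! i"] that by auto
  have eq: "?P (Node K cs) = ?R \<union> ?C"
  proof (rule set_eqI)
    fix v
    show "v \<in> ?P (Node K cs) \<longleftrightarrow> v \<in> ?R \<union> ?C"
      by (cases v) (auto simp: image_iff)
  qed
  have fin: "finite ?C" using IH by auto
  have "card (?P (Node K cs)) = card ?R + card ?C"
    unfolding eq using fin by (intro card_Un_disjoint) auto
  also have "card ?C = (\<Sum>i<length cs. card ((#) i ` ?P (cs ! i)))"
    using IH by (intro card_UN_disjoint) auto
  also have "\<dots> = (\<Sum>i<length cs. card (?P (cs ! i)))"
    by (intro sum.cong refl card_image) auto
  finally have "real (card (?P (Node K cs))) = real (card ?R) + (\<Sum>i<length cs. real (card (?P (cs ! i))))"
    by simp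
  also have "(\<Sum>i<length cs. real (card (?P (cs ! i)))) = (\<Sum>i<length cs. cnt (\<lambda>s. of_bool (q s)) (shape_of (cs ! i)))"
    using IH by (intro sum.cong) auto
  also have "\<dots> = sum_list (map (cnt (\<lambda>s. of_bool (q s))) (map shape_of cs))"
    by (simp add: sum_list_sum_nth atLeast0LessThan)
  finally show ?case unfolding eq using fin by auto
qed

text \<open>In a finite tree a longest address below \<open>v\<close> is a leaf, so the
  \<open>LEAST\<close> in \<open>rank\<close> is attained; ranks 0 and 1 then mean that
  \<open>v\<close> or one of its children is a leaf.\<close>

lemma two_le_rank_iff:
  assumes "finite V" "v \<in> V"
  shows "2 \<le> rank V v \<longleftrightarrow> \<not> is_leaf V v \<and> (\<forall>i. \<not> is_leaf V (v @ [i]))"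
proof -
  let ?W = "{w. v @ w \<in> V}"
  have "finite ?W" using finite_vimageI[OF assms(1), of "\<lambda>w. v @ w"] by (simp add: vimage_def inj_on_def)
  moreover have "[] \<in> ?W" using assms by simp
  ultimately obtain w where w: "w \<in> ?W" "\<And>w'. w' \<in> ?W \<Longrightarrow> length w' \<le> length w"
    using Max_in[of "length ` ?W"] Max_ge[of "length ` ?W"] by (smt (verit, best) empty_iff finite_imageI imageE imageI image_is_empty)
  have "is_leaf V (v @ w)"
    unfolding is_leaf_def using w by (metis append_assoc length_append_singleton mem_Collect_eq not_less_eq_eq order_refl)
  then have ex: "\<exists>w'. is_leaf V (v @ w') \<and> length w' = length w" by blast
  have L: "\<exists>w. is_leaf V (v @ w) \<and> length w = rank V v"
    unfolding rank_def by (rule LeastI[of "\<lambda>d. \<exists>w. is_leaf V (v @ w) \<and> length w = d", OF ex])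
  have le: "rank V v \<le> length w" if "is_leaf V (v @ w)" for w
    unfolding rank_def using that by (intro Least_le) blast
  show ?thesis
  proof
    assume "2 \<le> rank V v"
    then show "\<not> is_leaf V v \<and> (\<forall>i. \<not> is_leaf V (v @ [i]))"
      using le[of "[]"] le[of "[_]"] by fastforce
  next
    assume *: "\<not> is_leaf V v \<and> (\<forall>i. \<not> is_leaf V (v @ [i]))"
    obtain w where w: "is_leaf V (v @ w)" "length w = rank V v" using L by blast
    \<comment> \<open>The borrowed case rule splits \<open>w\<close> into the lengths 0, 1 and at
      least 2.\<close>
    show "2 \<le> rank V v"
      using * w by (cases w rule: remdups_adj.cases) auto
  qed
qed


section \<open>Insertion of a key as the choice of a gap\<close>

context mary
begin

text \<open>The last clause is the search property, expressed by the same count of smaller keys with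
  which \<open>insert_key\<close> selects a child. It also makes the key sets of the children
  disjoint.\<close>

fun valid :: "mtree \<Rightarrow> bool" where
  "valid (Node K cs) \<longleftrightarrow> finite K \<and>
     (if card K < m - 1 then cs = []
      else card K = m - 1 \<and> length cs = m \<and> (\<forall>c\<in>set cs. valid c) \<and>
        (\<forall>i<m. \<forall>y\<in>all_keys (cs ! i). y \<notin> K \<and> card {k \<in> K. k < y} = i))"

lemma valid_full:
  assumes "valid (Node K cs)" "\<not> card K < m - 1"
  shows "finite K" "card K = m - 1" "length cs = m" "i < m \<Longrightarrow> valid (cs ! i)"
    "i < m \<Longrightarrow> y \<in> all_keys (cs ! i) \<Longrightarrow> y \<notin> K \<and> card {k \<in> K. k < y} = i"
  using assms by auto

lemma all_keys_nth: "length cs = m \<Longrightarrow> (\<Union>c\<in>set cs. all_keys c) = (\<Union>i<m. all_keys (cs ! i))"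
  by (auto simp: set_conv_nth)

lemma valid_disjoint:
  assumes "valid (Node K cs)" "\<not> card K < m - 1" "i < m"
  shows "K \<inter> all_keys (cs ! i) = {}"
    "j < m \<Longrightarrow> i \<noteq> j \<Longrightarrow> all_keys (cs ! i) \<inter> all_keys (cs ! j) = {}"
proof -
  note key = valid_full(5)[OF assms(1,2)]
  show "K \<inter> all_keys (cs ! i) = {}" using key[OF assms(3)] by blast
  show "all_keys (cs ! i) \<inter> all_keys (cs ! j) = {}" if "j < m" "i \<noteq> j"
    using key[OF assms(3)] key[OF that(1)] that(2) by blast
qed

lemma valid_wf:
  assumes "valid t"
  shows "wf_shape (shape_of t) \<and> finite (all_keys t) \<and> card (all_keys t) = ssize (shape_of t)"
  using assms
proof (induction t)
  case (Node K cs)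
  show ?case
  proof (cases "card K < m - 1")
    case True
    then show ?thesis using Node.prems by simp
  next
    case False
    note full = valid_full[OF Node.prems False] and disj = valid_disjoint[OF Node.prems False]
    have IH: "wf_shape (shape_of (cs ! i))" "finite (all_keys (cs ! i))"
      "card (all_keys (cs ! i)) = ssize (shape_of (cs ! i))" if "i < m" for i
      using Node.IH[of "cs ! i"] full that by auto
    have "card (all_keys (Node K cs)) = card K + card (\<Union>i<m. all_keys (cs ! i))"
      unfolding all_keys.simps all_keys_nth[OF full(3)]     proof (rule card_Un_disjoint)
      show "K \<inter> (\<Union>i<m. all_keys (cs ! i)) = {}" using disj(1) by blast
    qed (use full(1) IH in auto)
    also have "card (\<Union>i<m. all_keys (cs ! i)) = (\<Sum>i<m. card (all_keys (cs ! i)))"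
      using IH disj(2) by (intro card_UN_disjoint) auto
    also have "\<dots> = (\<Sum>i<m. ssize (shape_of (cs ! i)))" using IH by (intro sum.cong) auto
    also have "\<dots> = sum_list (map ssize (map shape_of cs))"
      using full(3) by (simp add: sum_list_sum_nth atLeast0LessThan)
    finally have "card (all_keys (Node K cs)) = ssize (shape_of (Node K cs))" by simp
    moreover have "finite (all_keys (Node K cs))"
      unfolding all_keys.simps all_keys_nth[OF full(3)] using full(1) IH by auto
    moreover have "\<forall>c\<in>set cs. wf_shape (shape_of c)" using full(3) IH by (auto simp: in_set_conv_nth)
    then have "wf_shape (shape_of (Node K cs))" using full by simp
    ultimately show ?thesis by blast
  qed
qed

lemma valid_empty: "valid empty_node" "all_keys empty_node = {}" "shape_of empty_node = Shape 0 []"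
  using m_ge_2 by (auto simp: empty_node_def)

text \<open>The link to shapes: the gap that \<open>x\<close> hits is the rank of \<open>x\<close>
  among all keys present. This rank consists of \<open>i\<close> keys of \<open>K\<close>, all keys
  of the first \<open>i\<close> children and the smaller keys of child \<open>i\<close>; the first
  two parts together are the gaps of the first \<open>i\<close> children.\<close>

lemma insert_key_valid:
  assumes "valid t" "x \<notin> all_keys t"
  shows "valid (insert_key m x t) \<and> all_keys (insert_key m x t) = insert x (all_keys t) \<and>
    shape_of (insert_key m x t) = grow (card {y \<in> all_keys t. y < x}) (shape_of t)"
  using assms
proof (induction t)
  case (Node K cs)
  show ?case
  proof (cases "card K < m - 1")
    case True
    then have "finite K" "cs = []" "x \<notin> K" using Node.prems by auto
    then show ?thesis using True valid_empty by (auto simp: map_replicate_const)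
  next
    case False
    note full = valid_full[OF Node.prems(1) False] and disj = valid_disjoint[OF Node.prems(1) False]
    define i where "i = card {k \<in> K. k < x}"
    define c where "c = insert_key m x (cs ! i)"
    have "i \<le> card K" unfolding i_def using full(1) by (intro card_mono) auto
    then have i: "i < m" using full(2) m_ge_2 by linarith
    have ins: "insert_key m x (Node K cs) = Node K (cs[i := c])"
      using False i full(3) by (simp add: i_def c_def Let_def)
    have xc: "x \<notin> all_keys (cs ! j)" if "j < m" for j
      using that Node.prems(2) full(3) by auto
    have xK: "x \<notin> K" using Node.prems(2) by simp
    have IH: "valid c" "all_keys c = insert x (all_keys (cs ! i))"
      "shape_of c = grow (card {y \<in> all_keys (cs ! i). y < x}) (shape_of (cs ! i))"
      using Node.IH[of "cs ! i"] i full(3) full(4)[OF i] xc[OF i] unfolding c_def by auto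
    have len: "length (cs[i := c]) = m" using full(3) by simp
    have nth: "(cs[i := c]) ! j = (if j = i then c else cs ! j)" if "j < m" for j
      using that full(3) by simp
    have v: "valid (Node K (cs[i := c]))"
    proof -
      have "\<forall>c'\<in>set (cs[i := c]). valid c'"
        using nth len full(4) IH(1) by (metis in_set_conv_nth)
      moreover have "y \<notin> K \<and> card {k \<in> K. k < y} = j" if "j < m" "y \<in> all_keys (cs[i := c] ! j)" for j y
        using that nth[OF that(1)] full(5)[OF that(1), of y] IH(2) xK by (auto simp: i_def split: if_splits)
      ultimately show ?thesis using full(1,2) len False by simp
    qed
    have "all_keys (Node K (cs[i := c])) = K \<union> (\<Union>j<m. all_keys (cs[i := c] ! j))"
      using all_keys_nth[OF len] by simp
    also have "(\<Union>j<m. all_keys (cs[i := c] ! j)) = insert x (\<Union>j<m. all_keys (cs ! j))"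
      using i IH(2) nth by (auto split: if_splits)
    finally have k: "all_keys (Node K (cs[i := c])) = insert x (all_keys (Node K cs))"
      using all_keys_nth[OF full(3)] by simp
    let ?r = "card {y \<in> all_keys (cs ! i). y < x}"
    have fin: "finite (all_keys (cs ! j))" "card (all_keys (cs ! j)) = ssize (shape_of (cs ! j))" if "j < m" for j
      using valid_wf[OF full(4)[OF that]] by auto
    have mono: "card {k \<in> K. k < y} \<le> card {k \<in> K. k < z}" if "y \<le> z" for y z
      using that full(1) by (intro card_mono) auto
    \<comment> \<open>The number of keys of \<open>K\<close> below a real is monotone in that real,
      so children are ordered like their keys.\<close>
    have side: "y < x \<longleftrightarrow> j < i" if "j < m" "j \<noteq> i" "y \<in> all_keys (cs ! j)" for j y
      using full(5)[OF that(1,3)] mono[of y x] mono[of x y] that(2) unfolding i_def by fastforce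
    have "{y \<in> all_keys (Node K cs). y < x} =
       {k \<in> K. k < x} \<union> ((\<Union>j<i. all_keys (cs ! j)) \<union> {y \<in> all_keys (cs ! i). y < x})"
    proof -
      have "(y \<in> (\<Union>j<m. all_keys (cs ! j)) \<and> y < x) \<longleftrightarrow>
         y \<in> (\<Union>j<i. all_keys (cs ! j)) \<union> {y \<in> all_keys (cs ! i). y < x}" for y
      proof
        assume "y \<in> (\<Union>j<m. all_keys (cs ! j)) \<and> y < x"
        then obtain j where j: "j < m" "y \<in> all_keys (cs ! j)" "y < x" by blast
        then show "y \<in> (\<Union>j<i. all_keys (cs ! j)) \<union> {y \<in> all_keys (cs ! i). y < x}"
          using side[OF j(1) _ j(2)] by (cases "j = i") auto
      next
        assume "y \<in> (\<Union>j<i. all_keys (cs ! j)) \<union> {y \<in> all_keys (cs ! i). y < x}"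
        then consider j where "j < i" "y \<in> all_keys (cs ! j)" | "y \<in> all_keys (cs ! i)" "y < x" by blast
        then show "y \<in> (\<Union>j<m. all_keys (cs ! j)) \<and> y < x"
        proof cases
          case (1 j)
          then have "j < m" using i by simp
          then show ?thesis using side[of j y] 1 by auto
        next
          case 2
          then show ?thesis using i by blast
        qed
      qed
      then show ?thesis using all_keys_nth[OF full(3)] by auto
    qed
    then have "card {y \<in> all_keys (Node K cs). y < x} =
       card ({k \<in> K. k < x} \<union> ((\<Union>j<i. all_keys (cs ! j)) \<union> {y \<in> all_keys (cs ! i). y < x}))" by simp
    also have "\<dots> = card {k \<in> K. k < x} + card ((\<Union>j<i. all_keys (cs ! j)) \<union> {y \<in> all_keys (cs ! i). y < x})"
    proof (rule card_Un_disjoint)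
      have "K \<inter> all_keys (cs ! j) = {}" if "j < i" for j using disj(1)[of j] that i by simp
      with disj(1)[OF i] show "{k \<in> K. k < x} \<inter> ((\<Union>j<i. all_keys (cs ! j)) \<union> {y \<in> all_keys (cs ! i). y < x}) = {}"
        by blast
    qed (use full(1) fin i in auto)
    also have "card ((\<Union>j<i. all_keys (cs ! j)) \<union> {y \<in> all_keys (cs ! i). y < x}) =
       card (\<Union>j<i. all_keys (cs ! j)) + ?r"
    proof (rule card_Un_disjoint)
      have "all_keys (cs ! j) \<inter> all_keys (cs ! i) = {}" if "j < i" for j using disj(2)[of j i] that i by simp
      then show "(\<Union>j<i. all_keys (cs ! j)) \<inter> {y \<in> all_keys (cs ! i). y < x} = {}"
        by fastforce
    qed (use fin i in auto)
    also have "card (\<Union>j<i. all_keys (cs ! j)) = (\<Sum>j<i. card (all_keys (cs ! j)))"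
      using disj(2) fin i by (intro card_UN_disjoint) auto
    also have "\<dots> = (\<Sum>j<i. ssize (shape_of (cs ! j)))" using fin i by (intro sum.cong) auto
    also have "card {k \<in> K. k < x} + ((\<Sum>j<i. ssize (shape_of (cs ! j))) + ?r) = gaps (take i (map shape_of cs)) + ?r"
    proof -
      have "gaps (take i (map shape_of cs)) = (\<Sum>j<i. Suc (ssize (shape_of (cs ! j))))"
        using i full(3) by (simp add: sum_list_sum_nth atLeast0LessThan)
      also have "\<dots> = i + (\<Sum>j<i. ssize (shape_of (cs ! j)))"
        by (simp add: sum.distrib Suc_eq_plus1_left del: One_nat_def)
      finally show ?thesis by (simp add: i_def)
    qed
    finally have "card {y \<in> all_keys (Node K cs). y < x} = gaps (take i (map shape_of cs)) + ?r" .
    moreover have "?r \<le> card (all_keys (cs ! i))" using fin[OF i] by (intro card_mono) auto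
    then have "?r \<le> ssize (map shape_of cs ! i)" using fin[OF i] i full(3) by simp
    ultimately have "grow_child (card {y \<in> all_keys (Node K cs). y < x}) (map shape_of cs) =
      (map shape_of cs)[i := grow ?r (map shape_of cs ! i)]"
      using i full(3) by (simp add: grow_child_offset)
    also have "\<dots> = map shape_of (cs[i := c])"
      using IH(3) i full(3) by (simp add: map_update)
    finally have "shape_of (Node K (cs[i := c])) = grow (card {y \<in> all_keys (Node K cs). y < x}) (shape_of (Node K cs))"
      using False by simp
    then show ?thesis unfolding ins using v k by blast
  qed
qed

section \<open>Leaves and protection in terms of subtree sizes\<close>

lemma valid_subtree_at: "valid t \<Longrightarrow> subtree_at t v = Some s \<Longrightarrow> valid s"
proof (induction t v rule: subtree_at.induct)
  case (2 K cs i p)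
  then show ?case by (auto split: if_splits)
qed simp

lemma valid_nonempty_iff:
  assumes "valid s"
  shows "node_keys s \<noteq> {} \<longleftrightarrow> 1 \<le> ssize (shape_of s)"
proof (cases s)
  case (Node K cs)
  then show ?thesis using assms m_ge_2 by (cases "card K < m - 1") (auto simp: Suc_le_eq card_gt_0_iff)
qed

lemma nodes_valid:
  assumes "valid t"
  shows "nodes t = {v. \<exists>s. subtree_at t v = Some s \<and> 1 \<le> ssize (shape_of s)}"
  unfolding nodes_def using valid_subtree_at[OF assms] valid_nonempty_iff by blast

lemma card_nodes:
  assumes "valid t"
  shows "finite (nodes t)" "real (card (nodes t)) = node_count (shape_of t)"
  using card_positions[of t "\<lambda>s. 1 \<le> ssize s"] nodes_valid[OF assms] by (simp_all add: node_count_def)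

lemma child_in_nodes:
  assumes "valid t" "subtree_at t v = Some (Node K cs)"
  shows "v @ [i] \<in> nodes t \<longleftrightarrow> i < length cs \<and> 1 \<le> ssize (shape_of (cs ! i))"
  using assms by (simp add: nodes_valid subtree_at_append)

lemma is_leaf_nodes:
  assumes "valid t"
  shows "is_leaf (nodes t) v \<longleftrightarrow> (\<exists>s. subtree_at t v = Some s \<and> 1 \<le> ssize (shape_of s) \<and> ssize (shape_of s) < m)"
proof -
  have "(\<forall>i. v @ [i] \<notin> nodes t) \<longleftrightarrow> ssize (shape_of s) < m" if s: "subtree_at t v = Some s" for s
  proof (cases s)
    case (Node K cs)
    have val: "valid (Node K cs)" using valid_subtree_at[OF assms s] unfolding Node .
    have "(\<forall>i. v @ [i] \<notin> nodes t) \<longleftrightarrow> (\<forall>c\<in>set cs. ssize (shape_of c) = 0)"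
      using child_in_nodes[OF assms s[unfolded Node]] by (simp add: all_set_conv_all_nth Suc_le_eq)
    also have "\<dots> \<longleftrightarrow> ssize (shape_of (Node K cs)) < m"
    proof (cases "card K < m - 1")
      case True
      then show ?thesis using val by simp
    next
      case False
      have "ssize (shape_of (Node K cs)) = (m - 1) + sum_list (map ssize (map shape_of cs))"
        using valid_full(2)[OF val False] by simp
      then have "ssize (shape_of (Node K cs)) < m \<longleftrightarrow> sum_list (map ssize (map shape_of cs)) = 0"
        using m_ge_2 by linarith
      then show ?thesis by simp
    qed
    finally show ?thesis using Node by simp
  qed
  then show ?thesis unfolding is_leaf_def nodes_valid[OF assms] by blast
qed

lemma protected_nodes_valid:
  assumes "valid t"
  shows "protected_nodes 2 (nodes t) = {v. \<exists>s. subtree_at t v = Some s \<and> is_protected (shape_of s)}"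
proof -
  have "2 \<le> rank (nodes t) v \<longleftrightarrow> is_protected (shape_of s)"
    if s: "subtree_at t v = Some s" "1 \<le> ssize (shape_of s)" for v s
  proof (cases s)
    case (Node K cs)
    have "v \<in> nodes t" using s nodes_valid[OF assms] by blast
    then have "2 \<le> rank (nodes t) v \<longleftrightarrow> \<not> is_leaf (nodes t) v \<and> (\<forall>i. \<not> is_leaf (nodes t) (v @ [i]))"
      by (rule two_le_rank_iff[OF card_nodes(1)[OF assms]])
    also have "\<not> is_leaf (nodes t) v \<longleftrightarrow> m \<le> ssize (shape_of s)"
      using s by (auto simp: is_leaf_nodes[OF assms])
    also have "(\<forall>i. \<not> is_leaf (nodes t) (v @ [i])) \<longleftrightarrow> (\<forall>c\<in>set cs. ssize (shape_of c) = 0 \<or> m \<le> ssize (shape_of c))"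
    proof -
      have "\<not> is_leaf (nodes t) (v @ [i]) \<longleftrightarrow>
          (i < length cs \<longrightarrow> ssize (shape_of (cs ! i)) = 0 \<or> m \<le> ssize (shape_of (cs ! i)))" for i
        using s(1) Node by (auto simp: is_leaf_nodes[OF assms] subtree_at_append)
      then show ?thesis by (simp only: all_set_conv_all_nth)
    qed
    finally show ?thesis using Node by (simp add: is_protected_def)
  qed
  moreover have "1 \<le> ssize s" if "is_protected s" for s
    using that m_ge_2 by (cases s) (auto simp: is_protected_def)
  ultimately show ?thesis unfolding protected_nodes_def nodes_valid[OF assms] by fast
qed

lemma protected_fraction_valid:
  assumes "valid t"
  shows "protected_fraction 2 (nodes t) = protected_count (shape_of t) / node_count (shape_of t)"
  using card_positions[of t is_protected] card_nodes[OF assms]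
  unfolding protected_fraction_def protected_nodes_valid[OF assms] protected_count_def by simp

primrec shape_seq :: "(nat \<Rightarrow> nat) \<Rightarrow> nat \<Rightarrow> shape" where
  "shape_seq r 0 = Shape 0 []"
| "shape_seq r (Suc n) = grow (r n) (shape_seq r n)"

lemma shape_seq_wf:
  assumes "\<And>i. i < n \<Longrightarrow> r i \<le> i"
  shows "wf_shape (shape_seq r n) \<and> ssize (shape_seq r n) = n"
  using assms
proof (induction n)
  case (Suc n)
  then show ?case using grow_wf[of "shape_seq r n" "r n"] by simp
qed (use m_ge_2 in simp)

end

definition rel_rank :: "(nat \<Rightarrow> real) \<Rightarrow> nat \<Rightarrow> nat" where
  "rel_rank x i = card {j. j < i \<and> x j < x i}"

lemma rel_rank_le: "rel_rank x i \<le> i"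
  unfolding rel_rank_def using card_mono[of "{..<i}" "{j. j < i \<and> x j < x i}"] by auto

context mary
begin

lemma search_tree_shape:
  assumes "inj x"
  shows "valid (search_tree m (map x [0..<n])) \<and> all_keys (search_tree m (map x [0..<n])) = x ` {..<n} \<and>
    shape_of (search_tree m (map x [0..<n])) = shape_seq (rel_rank x) n"
proof (induction n)
  case 0
  then show ?case using valid_empty by (simp add: search_tree_def)
next
  case (Suc n)
  let ?t = "search_tree m (map x [0..<n])"
  have t: "search_tree m (map x [0..<Suc n]) = insert_key m (x n) ?t" by (simp add: search_tree_def)
  have notin: "x n \<notin> all_keys ?t" using Suc assms by (auto simp: inj_def)
  have "{y \<in> all_keys ?t. y < x n} = x ` {j. j < n \<and> x j < x n}" using Suc by auto
  then have "card {y \<in> all_keys ?t. y < x n} = rel_rank x n"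
    unfolding rel_rank_def using assms by (simp add: card_image inj_on_subset)
  then show ?case unfolding t using insert_key_valid[OF conjunct1[OF Suc] notin] Suc by (auto simp: lessThan_Suc)
qed

lemma protected_fraction_search_tree:
  assumes "inj x"
  shows "protected_fraction 2 (nodes (search_tree m (map x [0..<n]))) =
    protected_count (shape_seq (rel_rank x) n) / node_count (shape_seq (rel_rank x) n)"
  using search_tree_shape[OF assms] protected_fraction_valid by metis

end

section \<open>Relative ranks of exchangeable keys\<close>

lemma rel_rank_cong: "(\<And>j. j \<le> i \<Longrightarrow> x j = y j) \<Longrightarrow> rel_rank x i = rel_rank y i"
  unfolding rel_rank_def by (rule arg_cong[where f = card]) auto

text \<open>Relative ranks determine an arrangement from the end backwards: at the last position
  \<open>i\<close> where \<open>p\<close> and \<open>q\<close> differ, both have the same keys in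
  the positions up to \<open>i\<close>, and the rank among these determines the key at
  \<open>i\<close>.\<close>

lemma rel_rank_permuted_inj:
  assumes x: "inj x" and "p permutes {..<n}" "q permutes {..<n}"
    and eq: "\<And>i. i < n \<Longrightarrow> rel_rank (\<lambda>i. x (p i)) i = rel_rank (\<lambda>i. x (q i)) i"
  shows "p = q"
proof (rule ccontr)
  assume "p \<noteq> q"
  define E where "E = {i. p i \<noteq> q i}"
  have "E \<subseteq> {..<n}" unfolding E_def using assms(2,3) by (auto simp: permutes_def not_less) (metis not_le)
  then have fin: "finite E" by (rule finite_subset) simp
  have "E \<noteq> {}" using \<open>p \<noteq> q\<close> by (auto simp: E_def)
  define i where "i = Max E"
  have i: "i \<in> E" "i < n" unfolding i_def using Max_in[OF fin \<open>E \<noteq> {}\<close>] \<open>E \<subseteq> {..<n}\<close> by auto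
  have above: "p j = q j" if "j > i" for j
    using Max_ge[OF fin, of j] that by (fastforce simp: E_def i_def)
  have bij: "bij p" "bij q" using assms(2,3) by (auto intro: permutes_bij)
  have img: "p ` {..i} = q ` {..i}"
  proof -
    have "f ` {..i} = - (f ` {i<..})" if "bij f" for f :: "nat \<Rightarrow> nat"
      using bij_image_Compl_eq[OF that, of "{i<..}"] by (simp add: Compl_greaterThan)
    then have "p ` {..i} = - (p ` {i<..})" "q ` {..i} = - (q ` {i<..})"
      using bij by blast+
    moreover have "p ` {i<..} = q ` {i<..}" using above by (intro image_cong) auto
    ultimately show ?thesis by simp
  qed
  have rank: "rel_rank (\<lambda>i. x (f i)) i = card {s \<in> f ` {..i}. x s < x (f i)}" if "bij f" for f
  proof -
    have "{s \<in> f ` {..i}. x s < x (f i)} = f ` {j. j < i \<and> x (f j) < x (f i)}"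
      by (auto simp: le_less)
    moreover have "inj_on f {j. j < i \<and> x (f j) < x (f i)}"
      using bij_is_inj[OF that] by (rule inj_on_subset) simp
    ultimately show ?thesis unfolding rel_rank_def by (simp add: card_image)
  qed
  have less: "rel_rank (\<lambda>i. x (f i)) i < rel_rank (\<lambda>i. x (g i)) i"
    if "bij f" "bij g" "f ` {..i} = g ` {..i}" "x (f i) < x (g i)" for f g
    unfolding rank[OF that(1)] rank[OF that(2)] that(3)
  proof (rule psubset_card_mono)
    have "f i \<in> g ` {..i}" using that(3) by blast
    then show "{s \<in> g ` {..i}. x s < x (f i)} \<subset> {s \<in> g ` {..i}. x s < x (g i)}"
      using that(4) by fastforce
  qed simp
  have "x (p i) = x (q i)"
    using less[OF bij(1,2) img] less[OF bij(2,1) img[symmetric]] eq[OF i(2)] by fastforce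
  then have "p i = q i" using x by (simp add: inj_eq)
  then show False using i(1) by (simp add: E_def)
qed

lemma card_PiE_atMost: "card (\<Pi>\<^sub>E i\<in>{..<n::nat}. {..i}) = fact n"
  by (simp add: card_PiE fact_prod_Suc lessThan_atLeast0)

text \<open>The map from permutations to sequences of ranks is injective, and both sets have
  \<open>fact n\<close> elements.\<close>

lemma card_permutations_rel_rank:
  assumes x: "inj x" and a: "a \<in> (\<Pi>\<^sub>E i\<in>{..<n}. {..i})"
  shows "card {p. p permutes {..<n} \<and> (\<forall>i<n. rel_rank (\<lambda>i. x (p i)) i = a i)} = 1"
proof -
  let ?P = "{p. p permutes {..<n}}" and ?A = "\<Pi>\<^sub>E i\<in>{..<n}. {..i::nat}"
  let ?f = "\<lambda>p. restrict (rel_rank (\<lambda>i. x (p i))) {..<n}"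
  have inj: "inj_on ?f ?P"
  proof (rule inj_onI)
    fix p q assume "p \<in> ?P" "q \<in> ?P" "?f p = ?f q"
    then show "p = q" using rel_rank_permuted_inj[OF x, of p n q]
      by (metis lessThan_iff mem_Collect_eq restrict_apply')
  qed
  have sub: "?f ` ?P \<subseteq> ?A"
    by (rule image_subsetI) (rule iffD2[OF restrict_PiE_iff], simp add: rel_rank_le)
  have "card (?f ` ?P) = card ?A"
    unfolding card_image[OF inj] card_PiE_atMost by (simp add: card_permutations)
  then have "?f ` ?P = ?A" using sub by (intro card_subset_eq finite_PiE) auto
  then obtain p where p: "p \<in> ?P" "?f p = a" using a by (metis (no_types, lifting) imageE)
  have "{p. p permutes {..<n} \<and> (\<forall>i<n. rel_rank (\<lambda>i. x (p i)) i = a i)} = {p}"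
  proof
    show "{p} \<subseteq> {p. p permutes {..<n} \<and> (\<forall>i<n. rel_rank (\<lambda>i. x (p i)) i = a i)}"
      using p by auto
    show "{p. p permutes {..<n} \<and> (\<forall>i<n. rel_rank (\<lambda>i. x (p i)) i = a i)} \<subseteq> {p}"
    proof
      fix q assume q: "q \<in> {p. p permutes {..<n} \<and> (\<forall>i<n. rel_rank (\<lambda>i. x (p i)) i = a i)}"
      then have "rel_rank (\<lambda>i. x (q i)) i = rel_rank (\<lambda>i. x (p i)) i" if "i < n" for i
        using p(2) that by auto
      then show "q \<in> {p}" using rel_rank_permuted_inj[OF x, of q n p] p(1) q by auto
    qed
  qed
  then show ?thesis by simp
qed

lemma real_rel_rank: "real (rel_rank x i) = (\<Sum>j<i. of_bool (x j < x i))"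
proof -
  have "{j. j < i \<and> x j < x i} = {..<i} \<inter> {j. x j < x i}" by auto
  then show ?thesis by (simp add: rel_rank_def)
qed

lemma borel_measurable_rel_rank:
  assumes "i < n"
  shows "(\<lambda>x. real (rel_rank x i)) \<in> borel_measurable (PiM {..<n} (\<lambda>_. borel))"
proof -
  have "(\<lambda>x. of_bool (x j < x i) :: real) \<in> borel_measurable (PiM {..<n} (\<lambda>_. borel :: real measure))"
    if "j < i" for j
  proof -
    have c: "(\<lambda>x. x j) \<in> borel_measurable (PiM {..<n} (\<lambda>_. borel :: real measure))"
        "(\<lambda>x. x i) \<in> borel_measurable (PiM {..<n} (\<lambda>_. borel :: real measure))"
        using that assms by (auto intro!: measurable_component_singleton)
    show ?thesis unfolding of_bool_def 
      by (rule measurable_If[OF borel_measurable_const borel_measurable_const borel_measurable_less[OF c]])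
  qed
  then show ?thesis unfolding real_rel_rank by (intro borel_measurable_sum) simp
qed

section \<open>Uniform distribution of the relative ranks\<close>

context prob_space
begin

text \<open>A law with continuous distribution function has no atoms, so by independence and Fubini
  the diagonal is a null set for each of the countably many pairs of indices.\<close>

lemma AE_distinct:
  fixes X :: "nat \<Rightarrow> 'a \<Rightarrow> real"
  assumes indep: "indep_vars (\<lambda>_. borel) X UNIV"
    and ident: "\<And>i. distr M borel (X i) = D"
    and cont: "continuous_on UNIV (cdf D)"
  shows "AE \<omega> in M. inj (\<lambda>i. X i \<omega>)"
proof -
  have rv [measurable]: "random_variable borel (X i)" for i
    using indep by (auto simp: indep_vars_def)
  interpret D: real_distribution D
    using ident[of 0] real_distribution_distr[OF rv[of 0]] by simp
  have atom: "emeasure D {x} = 0" for x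
  proof -
    have "isCont (cdf D) x" using cont by (simp add: continuous_on_eq_continuous_at)
    then show ?thesis using D.isCont_cdf by (simp add: D.emeasure_eq_measure)
  qed
  have "AE \<omega> in M. X i \<omega> \<noteq> X j \<omega>" if ij: "i \<noteq> j" for i j
  proof -
    have "indep_var (PiM {i} (\<lambda>_. borel)) (\<lambda>\<omega>. restrict (\<lambda>i. X i \<omega>) {i}) (PiM {j} (\<lambda>_. borel)) (\<lambda>\<omega>. restrict (\<lambda>i. X i \<omega>) {j})"
      using ij by (intro indep_var_restrict[OF indep]) auto
    then have "indep_var borel ((\<lambda>f. f i) \<circ> (\<lambda>\<omega>. restrict (\<lambda>i. X i \<omega>) {i})) borel ((\<lambda>f. f j) \<circ> (\<lambda>\<omega>. restrict (\<lambda>i. X i \<omega>) {j}))"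
      by (rule indep_var_compose) auto
    then have "indep_var borel (X i) borel (X j)" by (simp add: comp_def)
    then have eq: "D \<Otimes>\<^sub>M D = distr M (borel \<Otimes>\<^sub>M borel) (\<lambda>\<omega>. (X i \<omega>, X j \<omega>))"
      by (simp add: indep_var_distribution_eq ident)
    have meas: "{z::real \<times> real. fst z = snd z} \<in> sets (borel \<Otimes>\<^sub>M borel)"
    proof -
      have "{z \<in> space (borel \<Otimes>\<^sub>M borel). fst z = (snd z :: real)} \<in> sets (borel \<Otimes>\<^sub>M borel)"
        by measurable
      then show ?thesis by (simp add: space_pair_measure)
    qed
    have "emeasure (D \<Otimes>\<^sub>M D) {z. fst z = snd z} = (\<integral>\<^sup>+x. emeasure D (Pair x -` {z. fst z = snd z}) \<partial>D)"
    proof (rule D.emeasure_pair_measure_alt)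
      have "sets (D \<Otimes>\<^sub>M D) = sets (borel \<Otimes>\<^sub>M borel)" by (intro sets_pair_measure_cong) auto
      then show "{z. fst z = snd z} \<in> sets (D \<Otimes>\<^sub>M D)" using meas by simp
    qed
    also have "\<dots> = (\<integral>\<^sup>+x. emeasure D {x} \<partial>D)"
    proof (rule nn_integral_cong)
      fix x :: real
      have "Pair x -` {z. fst z = snd z} = {x}" by auto
      then show "emeasure D (Pair x -` {z. fst z = snd z}) = emeasure D {x}" by simp
    qed
    also have "\<dots> = 0" by (simp add: atom)
    finally have "emeasure M {\<omega> \<in> space M. X i \<omega> = X j \<omega>} = 0"
      unfolding eq by (subst (asm) emeasure_distr) (auto simp: meas vimage_def Int_def conj_commute)
    then show ?thesis by (intro AE_I[of _ _ "{\<omega> \<in> space M. X i \<omega> = X j \<omega>}"]) auto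
  qed
  then have "AE \<omega> in M. \<forall>i j. i \<noteq> j \<longrightarrow> X i \<omega> \<noteq> X j \<omega>"
    unfolding AE_all_countable by (simp add: AE_all_countable)
  then show ?thesis by eventually_elim (auto simp: inj_def)
qed

lemma distr_permuted:
  fixes X :: "nat \<Rightarrow> 'a \<Rightarrow> real"
  assumes indep: "indep_vars (\<lambda>_. borel) X UNIV"
    and ident: "\<And>i. distr M borel (X i) = D"
    and p: "p permutes {..<n}"
  shows "distr M (PiM {..<n} (\<lambda>_. borel)) (\<lambda>\<omega>. \<lambda>i\<in>{..<n}. X (p i) \<omega>) = PiM {..<n} (\<lambda>_. D)"
proof (cases "n = 0")
  case False
  let ?J = "{..<n}"
  have rv [measurable]: "random_variable borel (X i)" for i
    using indep by (auto simp: indep_vars_def)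
  have D: "prob_space D" using ident[of 0] prob_space_distr[OF rv[of 0]] by simp
  have sets: "sets D = sets borel" using ident[of 0] by (metis sets_distr)
  have "indep_vars (\<lambda>_. borel) X ?J" using indep by (rule indep_vars_subset) simp
  then have id: "distr M (PiM ?J (\<lambda>_. borel)) (\<lambda>\<omega>. \<lambda>i\<in>?J. X i \<omega>) = PiM ?J (\<lambda>_. D)"
    using False by (subst (asm) indep_vars_iff_distr_eq_PiM) (auto simp: ident)
  have img: "p i < n" if "i < n" for i using p that by (metis lessThan_iff permutes_in_image)
  have "distr M (PiM ?J (\<lambda>_. borel)) (\<lambda>\<omega>. \<lambda>i\<in>?J. X (p i) \<omega>) =
     distr M (PiM ?J (\<lambda>_. borel)) ((\<lambda>x. \<lambda>i\<in>?J. x (p i)) \<circ> (\<lambda>\<omega>. \<lambda>i\<in>?J. X i \<omega>))"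
    using img by (intro distr_cong) (auto simp: fun_eq_iff)
  also have "\<dots> = distr (PiM ?J (\<lambda>_. D)) (PiM ?J (\<lambda>_. borel)) (\<lambda>x. \<lambda>i\<in>?J. x (p i))"
    unfolding id[symmetric] using img
    by (intro distr_distr[symmetric]) (auto intro!: measurable_restrict measurable_component_singleton)
  also have "\<dots> = distr (PiM ?J (\<lambda>_. D)) (PiM ?J (\<lambda>_. D)) (\<lambda>x. \<lambda>i\<in>?J. x (p i))"
    using sets by (intro distr_cong sets_PiM_cong) auto
  also have "\<dots> = PiM ?J (\<lambda>_. D)"
    using img D permutes_inj[OF p] by (intro distr_PiM_reindex) (auto intro: inj_on_subset)
  finally show ?thesis .
next
  \<comment> \<open>Without coordinates, both sides are the probability measure on the one-point
    space.\<close>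
  case True
  have rv [measurable]: "random_variable borel (X i)" for i
    using indep by (auto simp: indep_vars_def)
  show ?thesis unfolding True
  proof (rule measure_eqI)
    let ?f = "\<lambda>\<omega>. \<lambda>i\<in>{..<0::nat}. X (p i) \<omega>"
    fix A assume "A \<in> sets (distr M (PiM {..<0::nat} (\<lambda>_. borel)) ?f)"
    then have A: "A \<in> sets (PiM {..<0::nat} (\<lambda>_. borel :: real measure))" by simp
    have f: "?f \<in> measurable M (PiM {..<0::nat} (\<lambda>_. borel))" by (intro measurable_restrict) simp
    from A have "A = {} \<or> A = {\<lambda>_. undefined}" by (auto simp: sets_PiM_empty)
    then show "emeasure (distr M (PiM {..<0::nat} (\<lambda>_. borel)) ?f) A = emeasure (PiM {..<0} (\<lambda>_. D)) A"
    proof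
      assume *: "A = {\<lambda>_. undefined}"
      then have "?f -` A \<inter> space M = space M" by (auto simp: restrict_def)
      then show ?thesis unfolding emeasure_distr[OF f A]
        by (simp add: * PiM_empty emeasure_space_1)
    qed simp
  qed (simp add: sets_PiM_empty)
qed

text \<open>The \<open>fact n\<close> reorderings of the keys have the same joint distribution, and almost surely exactly
  one of them has the relative ranks \<open>a\<close>.\<close>
lemma prob_rel_rank:
  fixes X :: "nat \<Rightarrow> 'a \<Rightarrow> real"
  assumes indep: "indep_vars (\<lambda>_. borel) X UNIV"
    and ident: "\<And>i. distr M borel (X i) = D"
    and cont: "continuous_on UNIV (cdf D)"
    and a: "a \<in> (\<Pi>\<^sub>E i\<in>{..<n}. {..i})"
  shows "prob {\<omega> \<in> space M. \<forall>i<n. rel_rank (\<lambda>i. X i \<omega>) i = a i} = 1 / fact n"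
proof -
  have rv [measurable]: "random_variable borel (X i)" for i
    using indep by (auto simp: indep_vars_def)
  let ?P = "{p. p permutes {..<n}}"
  let ?B = "{x \<in> space (PiM {..<n} (\<lambda>_. borel)). \<forall>i<n. real (rel_rank x i) = real (a i)}"
  define E where "E p = {\<omega> \<in> space M. \<forall>i<n. rel_rank (\<lambda>i. X (p i) \<omega>) i = a i}" for p :: "nat \<Rightarrow> nat"
  have finP: "finite ?P" by (rule finite_permutations) simp
  have B: "?B \<in> sets (PiM {..<n} (\<lambda>_. borel))"
  proof -
    have "{x \<in> space (PiM {..<n} (\<lambda>_. borel)). real (rel_rank x i) = real (a i)} \<in> sets (PiM {..<n} (\<lambda>_. borel))"
      if "i < n" for i by (rule borel_measurable_eq[OF borel_measurable_rel_rank[OF that] borel_measurable_const])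
    then have "{x \<in> space (PiM {..<n} (\<lambda>_. borel)). \<forall>i\<in>{..<n}. real (rel_rank x i) = real (a i)} \<in> sets (PiM {..<n} (\<lambda>_. borel))"
      by (intro sets.sets_Collect_finite_All finite_lessThan) (simp only: lessThan_iff)
    then show ?thesis by (simp only: Ball_def lessThan_iff)
  qed
  have E_vimage: "E p = (\<lambda>\<omega>. \<lambda>i\<in>{..<n}. X (p i) \<omega>) -` ?B \<inter> space M" for p
  proof -
    have "rel_rank (\<lambda>i\<in>{..<n}. X (p i) \<omega>) i = rel_rank (\<lambda>i. X (p i) \<omega>) i" if "i < n" for i \<omega>
      using that by (intro rel_rank_cong) auto
    then show ?thesis by (auto simp: E_def space_PiM)
  qed
  have map: "(\<lambda>\<omega>. \<lambda>i\<in>{..<n}. X (p i) \<omega>) \<in> measurable M (PiM {..<n} (\<lambda>_. borel))" for p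
    by (intro measurable_restrict) simp
  have E_sets: "E p \<in> events" for p
    unfolding E_vimage using B map by (rule measurable_sets[rotated])
  have E_prob: "prob (E p) = measure (PiM {..<n} (\<lambda>_. D)) ?B" if "p \<in> ?P" for p
  proof -
    have "measure (PiM {..<n} (\<lambda>_. D)) ?B = measure (distr M (PiM {..<n} (\<lambda>_. borel)) (\<lambda>\<omega>. \<lambda>i\<in>{..<n}. X (p i) \<omega>)) ?B"
      using that by (simp add: distr_permuted[OF indep ident])
    also have "\<dots> = prob (E p)" unfolding E_vimage using map B by (rule measure_distr)
    finally show ?thesis by simp
  qed
  have "AE \<omega> in M. (\<Sum>p\<in>?P. indicator (E p) \<omega>) = (1 :: real)"
    using AE_distinct[OF indep ident cont] AE_space
  proof eventually_elim
    case (elim \<omega>)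
    have "(\<Sum>p\<in>?P. indicator (E p) \<omega> :: real) = (\<Sum>p\<in>?P. of_bool (\<forall>i<n. rel_rank (\<lambda>i. X (p i) \<omega>) i = a i))"
      using elim(2) by (intro sum.cong refl) (auto simp: E_def indicator_def)
    also have "\<dots> = real (card (?P \<inter> {p. \<forall>i<n. rel_rank (\<lambda>i. X (p i) \<omega>) i = a i}))"
      using finP by simp
    also have "?P \<inter> {p. \<forall>i<n. rel_rank (\<lambda>i. X (p i) \<omega>) i = a i} =
        {p. p permutes {..<n} \<and> (\<forall>i<n. rel_rank (\<lambda>i. X (p i) \<omega>) i = a i)}" by auto
    finally show ?case using card_permutations_rel_rank[OF elim(1) a] by simp
  qed
  then have "expectation (\<lambda>\<omega>. \<Sum>p\<in>?P. indicator (E p) \<omega>) = expectation (\<lambda>\<omega>. 1 :: real)"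
    using E_sets by (intro integral_cong_AE) auto
  moreover have "expectation (\<lambda>\<omega>. \<Sum>p\<in>?P. indicator (E p) \<omega> :: real) = (\<Sum>p\<in>?P. prob (E p))"
  proof -
    have "integrable M (indicator (E p) :: 'a \<Rightarrow> real)" for p
      using E_sets[of p] by (simp add: integrable_indicator_iff emeasure_eq_measure)
    then have "expectation (\<lambda>\<omega>. \<Sum>p\<in>?P. indicator (E p) \<omega> :: real) = (\<Sum>p\<in>?P. expectation (indicator (E p)))"
      by (rule Bochner_Integration.integral_sum)
    moreover have "expectation (indicator (E p)) = prob (E p)" for p
      using sets.sets_into_space[OF E_sets[of p]] by (simp add: Int_absorb2)
    ultimately show ?thesis by simp
  qed
  moreover have "(\<Sum>p\<in>?P. prob (E p)) = fact n * prob (E id)"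
  proof -
    have "id \<in> ?P" by (simp add: permutes_id)
    then have "prob (E p) = prob (E id)" if "p \<in> ?P" for p
      using E_prob[OF that] E_prob[of id] by linarith
    then have "(\<Sum>p\<in>?P. prob (E p)) = (\<Sum>p\<in>?P. prob (E id))" by (intro sum.cong refl)
    also have "\<dots> = real (card ?P) * prob (E id)" by (rule sum_constant)
    also have "card ?P = fact n" by (rule card_permutations) auto
    finally show ?thesis by (simp only: of_nat_fact)
  qed
  ultimately have "fact n * prob (E id) = 1" by (simp add: prob_space)
  then have "prob (E id) = 1 / fact n" by (simp add: field_simps)
  then show ?thesis unfolding E_def id_apply .
qed

end

text \<open>If \<open>\<bar>V n\<bar>\<close> reached \<open>\<epsilon> * (n + 1)\<close> for a late
  \<open>n\<close>, bounded steps would keep it above half of that over a window of length about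
  \<open>\<delta> * (n + 1)\<close>; the window would contribute at least
  \<open>\<epsilon>\<^sup>2 * \<delta> / 32\<close> to the series, against the Cauchy
  criterion.\<close>

lemma tendsto_zero_of_weighted_squares:
  fixes V :: "nat \<Rightarrow> real"
  assumes step: "\<And>n. \<bar>V (Suc n) - V n\<bar> \<le> K"
    and summable: "summable (\<lambda>n. (V n)\<^sup>2 / (real n + 1) ^ 3)"
  shows "(\<lambda>n. V n / (real n + 1)) \<longlonglongrightarrow> 0"
proof (rule LIMSEQ_I)
  fix \<epsilon> :: real assume \<epsilon>: "\<epsilon> > 0"
  \<comment> \<open>The maximum makes \<open>L\<close> positive and \<open>\<delta> \<le> 1\<close>,
    which keeps \<open>l + 1\<close> below \<open>2 * (n + 1)\<close> on the window.\<close>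
  define L where "L = max K \<epsilon>"
  define \<delta> where "\<delta> = \<epsilon> / (2 * L)"
  have L: "L > 0" "K \<le> L" "\<epsilon> \<le> L" unfolding L_def using \<epsilon> by auto
  have \<delta>: "\<delta> > 0" "\<delta> \<le> 1" "L * \<delta> = \<epsilon> / 2" unfolding \<delta>_def using L \<epsilon> by (auto simp: field_simps)
  have lip: "\<bar>V (n + k) - V n\<bar> \<le> L * real k" for n k
  proof (induction k)
    case (Suc k)
    then show ?case using step[of "n + k"] L(2) by (simp add: algebra_simps)
  qed simp
  have "\<epsilon>\<^sup>2 * \<delta> / 32 > 0" using \<epsilon> \<delta> by simp
  then obtain N where N: "\<And>n k. n \<ge> N \<Longrightarrow> norm (\<Sum>l = n..<k. (V l)\<^sup>2 / (real l + 1) ^ 3) < \<epsilon>\<^sup>2 * \<delta> / 32"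
    using summable unfolding summable_Cauchy by meson
  have "\<bar>V n\<bar> < \<epsilon> * (real n + 1)" if n: "n \<ge> N" for n
  proof (rule ccontr)
    assume neg: "\<not> \<bar>V n\<bar> < \<epsilon> * (real n + 1)"
    let ?x = "real n + 1"
    define q where "q = nat \<lfloor>\<delta> * ?x\<rfloor>"
    have q: "real q \<le> \<delta> * ?x" "\<delta> * ?x \<le> real q + 1" unfolding q_def using \<delta> by (auto simp: of_nat_floor)
    \<comment> \<open>The 32 is 4 times 8: half the height enters squared, twice the argument
      cubed.\<close>
    have term_ge: "\<epsilon>\<^sup>2 / (32 * ?x) \<le> (V l)\<^sup>2 / (real l + 1) ^ 3" if l: "l \<in> {n..<n + q + 1}" for l
    proof -
      have k: "real (l - n) \<le> \<delta> * ?x" "l = n + (l - n)" using l q(1) by auto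
      have "L * real (l - n) \<le> L * (\<delta> * ?x)" using k L by (intro mult_left_mono) auto
      also have "\<dots> = \<epsilon> / 2 * ?x" using \<delta>(3) by (simp add: mult.assoc[symmetric])
      finally have "\<bar>V l - V n\<bar> \<le> \<epsilon> / 2 * ?x" using lip[of n "l - n"] k(2) by simp
      moreover have "\<epsilon> / 2 * ?x = \<epsilon> * ?x / 2" by simp
      ultimately have "\<epsilon> / 2 * ?x \<le> \<bar>V l\<bar>" using neg by linarith
      then have "(\<epsilon> / 2 * ?x)\<^sup>2 \<le> \<bar>V l\<bar>\<^sup>2" using \<epsilon> by (intro power_mono) auto
      then have V: "\<epsilon>\<^sup>2 / 4 * ?x\<^sup>2 \<le> (V l)\<^sup>2" by (simp add: power_mult_distrib power_divide)
      note k(1)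
      also have "\<delta> * ?x \<le> 1 * ?x" using \<delta>(2) by (intro mult_right_mono) auto
      finally have "real (l - n) \<le> ?x" by simp
      then have "real l + 1 \<le> 2 * ?x" using l by (simp add: of_nat_diff)
      then have "(real l + 1) ^ 3 \<le> (2 * ?x) ^ 3" by (intro power_mono) auto
      then have "\<epsilon>\<^sup>2 / 4 * ?x\<^sup>2 / (2 * ?x) ^ 3 \<le> (V l)\<^sup>2 / (real l + 1) ^ 3"
        using V by (intro frac_le) auto
      moreover have "a / 4 * x\<^sup>2 / (2 * x) ^ 3 = a / (32 * x)" if "x > 0" for a x :: real
        using that by (simp add: power2_eq_square power3_eq_cube field_simps)
      from this[of ?x "\<epsilon>\<^sup>2"] have "\<epsilon>\<^sup>2 / 4 * ?x\<^sup>2 / (2 * ?x) ^ 3 = \<epsilon>\<^sup>2 / (32 * ?x)" by simp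
      ultimately show ?thesis by (simp only:)
    qed
    have "\<epsilon>\<^sup>2 * \<delta> / 32 = (\<delta> * ?x) * (\<epsilon>\<^sup>2 / (32 * ?x))" by (simp add: field_simps)
    also have "\<dots> \<le> (real q + 1) * (\<epsilon>\<^sup>2 / (32 * ?x))" using q(2) by (intro mult_right_mono) auto
    also have "\<dots> = (\<Sum>l = n..<n + q + 1. \<epsilon>\<^sup>2 / (32 * ?x))" by (simp add: algebra_simps)
    also have "\<dots> \<le> (\<Sum>l = n..<n + q + 1. (V l)\<^sup>2 / (real l + 1) ^ 3)" by (intro sum_mono term_ge)
    also have "\<dots> \<le> norm (\<Sum>l = n..<n + q + 1. (V l)\<^sup>2 / (real l + 1) ^ 3)" by simp
    also have "\<dots> < \<epsilon>\<^sup>2 * \<delta> / 32" using n by (rule N)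
    finally show False by simp
  qed
  then show "\<exists>N. \<forall>n\<ge>N. norm (V n / (real n + 1) - 0) < \<epsilon>"
    by (intro exI[of _ N]) (auto simp: abs_divide divide_less_eq)
qed

section \<open>Almost sure convergence\<close>

context mary
begin

lemma shape_seq_cong: "(\<And>i. i < n \<Longrightarrow> a i = b i) \<Longrightarrow> shape_seq a n = shape_seq b n"
  by (induction n) auto

text \<open>Unrolls the recursion: each sequence of gaps \<open>a i \<le> i\<close> carries the
  weight \<open>1 / fact n\<close>, which matches \<open>prob_rel_rank\<close>.\<close>

lemma expect_eq_sum:
  "expect n F = (\<Sum>a\<in>(\<Pi>\<^sub>E i\<in>{..<n}. {..i}). F (shape_seq a n)) / fact n"
proof (induction n arbitrary: F)
  case (Suc n)
  let ?A = "\<lambda>n. \<Pi>\<^sub>E i\<in>{..<n::nat}. {..i}"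
  have "?A (Suc n) = (\<lambda>(r, a). a(n := r)) ` ({..n} \<times> ?A n)"
    unfolding lessThan_Suc by (rule PiE_insert_eq)
  moreover have "inj_on (\<lambda>(r, a). a(n := r)) ({..n} \<times> ?A n)"
    by (rule inj_combinator) simp
  ultimately have "(\<Sum>a\<in>?A (Suc n). F (shape_seq a (Suc n))) =
      (\<Sum>(r, a)\<in>{..n} \<times> ?A n. F (shape_seq (a(n := r)) (Suc n)))"
    by (simp add: sum.reindex case_prod_unfold comp_def)
  also have "\<dots> = (\<Sum>(r, a)\<in>{..n} \<times> ?A n. F (grow r (shape_seq a n)))"
  proof (intro sum.cong refl, clarsimp)
    fix r a
    have "shape_seq (a(n := r)) n = shape_seq a n" by (rule shape_seq_cong) simp
    then show "F (grow r (shape_seq (a(n := r)) n)) = F (grow r (shape_seq a n))" by simp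
  qed
  also have "\<dots> = (\<Sum>a\<in>?A n. \<Sum>r\<le>n. F (grow r (shape_seq a n)))"
    unfolding sum.cartesian_product[symmetric] by (rule sum.swap)
  finally have "(\<Sum>a\<in>?A (Suc n). F (shape_seq a (Suc n))) / fact (Suc n) =
     (\<Sum>a\<in>?A n. (\<Sum>r\<le>n. F (grow r (shape_seq a n))) / (real n + 1)) / fact n"
    by (simp add: sum_divide_distrib[symmetric] add.commute)
  then show ?case using Suc.IH by simp
qed simp

end

locale random_search_tree = prob_space M + mary m
  for M :: "'a measure" and m :: nat +
  fixes X :: "nat \<Rightarrow> 'a \<Rightarrow> real" and D :: "real measure"
  assumes indep: "indep_vars (\<lambda>_. borel) X UNIV"
    and ident: "\<And>i. distr M borel (X i) = D"
    and cont: "continuous_on UNIV (cdf D)"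
begin

definition tree :: "nat \<Rightarrow> 'a \<Rightarrow> shape" where
  "tree n \<omega> = shape_seq (rel_rank (\<lambda>i. X i \<omega>)) n"

lemma tree_wf: "wf_shape (tree n \<omega>)" "ssize (tree n \<omega>) = n"
  using shape_seq_wf[of n "rel_rank (\<lambda>i. X i \<omega>)"] rel_rank_le by (auto simp: tree_def)

lemma tree_Suc: "tree (Suc n) \<omega> = grow (rel_rank (\<lambda>i. X i \<omega>) n) (tree n \<omega>)"
  by (simp add: tree_def)

lemma rank_event: "{\<omega> \<in> space M. \<forall>i<n. rel_rank (\<lambda>i. X i \<omega>) i = a i} \<in> events"
proof -
  have rv: "random_variable borel (X i)" for i
    using indep by (auto simp: indep_vars_def)
  have "(\<lambda>\<omega>. real (rel_rank (\<lambda>i. X i \<omega>) i)) \<in> borel_measurable M" for i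
    unfolding real_rel_rank of_bool_def
    by (rule borel_measurable_sum)
      (rule measurable_If[OF borel_measurable_const borel_measurable_const borel_measurable_less[OF rv rv]])
  then have "{\<omega> \<in> space M. real (rel_rank (\<lambda>i. X i \<omega>) i) = real (a i)} \<in> events" for i
    by (rule borel_measurable_eq[OF _ borel_measurable_const])
  then have "{\<omega> \<in> space M. \<forall>i\<in>{..<n}. real (rel_rank (\<lambda>i. X i \<omega>) i) = real (a i)} \<in> events"
    by (intro sets.sets_Collect_finite_All finite_lessThan)
  then show ?thesis by (simp only: Ball_def lessThan_iff of_nat_eq_iff)
qed

text \<open>The tree takes finitely many values, so every function of it is a finite combination of
  indicators of rank events. Integrability thus follows without a sigma-algebra on shapes.\<close>

lemma tree_eq_sum:
  fixes F :: "shape \<Rightarrow> real"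
  assumes "\<omega> \<in> space M"
  shows "F (tree n \<omega>) = (\<Sum>a\<in>(\<Pi>\<^sub>E i\<in>{..<n}. {..i}).
    indicator {\<omega> \<in> space M. \<forall>i<n. rel_rank (\<lambda>i. X i \<omega>) i = a i} \<omega> * F (shape_seq a n))"
proof -
  let ?A = "\<Pi>\<^sub>E i\<in>{..<n}. {..i}"
  let ?a = "restrict (rel_rank (\<lambda>i. X i \<omega>)) {..<n}"
  have a: "?a \<in> ?A" by (rule iffD2[OF restrict_PiE_iff]) (simp add: rel_rank_le)
  have "(\<Sum>a\<in>?A. indicator {\<omega> \<in> space M. \<forall>i<n. rel_rank (\<lambda>i. X i \<omega>) i = a i} \<omega> * F (shape_seq a n)) =
    (\<Sum>a\<in>?A. if a = ?a then F (shape_seq a n) else 0)"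
  proof (intro sum.cong refl)
    fix b assume b: "b \<in> ?A"
    have "b = ?a \<longleftrightarrow> (\<forall>i<n. rel_rank (\<lambda>i. X i \<omega>) i = b i)"
    proof
      assume "\<forall>i<n. rel_rank (\<lambda>i. X i \<omega>) i = b i"
      then show "b = ?a" by (intro PiE_ext[OF b a]) simp
    qed simp
    then show "indicator {\<omega> \<in> space M. \<forall>i<n. rel_rank (\<lambda>i. X i \<omega>) i = b i} \<omega> * F (shape_seq b n) =
      (if b = ?a then F (shape_seq b n) else 0)"
      using assms by (simp add: indicator_def)
  qed
  also have "\<dots> = F (shape_seq ?a n)" using a by (simp add: sum.delta finite_PiE)
  also have "shape_seq ?a n = tree n \<omega>" unfolding tree_def by (rule shape_seq_cong) simp
  finally show ?thesis by simp
qed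

lemma
  fixes F :: "shape \<Rightarrow> real"
  shows integrable_tree: "integrable M (\<lambda>\<omega>. F (tree n \<omega>))"
    and expectation_tree: "expectation (\<lambda>\<omega>. F (tree n \<omega>)) = expect n F"
proof -
  let ?A = "\<Pi>\<^sub>E i\<in>{..<n}. {..i}"
  define E where "E a = {\<omega> \<in> space M. \<forall>i<n. rel_rank (\<lambda>i. X i \<omega>) i = a i}" for a :: "nat \<Rightarrow> nat"
  have E: "E a \<in> events" for a unfolding E_def by (rule rank_event)
  have int: "integrable M (\<lambda>\<omega>. indicator (E a) \<omega> * F (shape_seq a n))" for a
    using E[of a] by (intro integrable_mult_left) (simp add: integrable_indicator_iff emeasure_eq_measure)
  then have int_sum: "integrable M (\<lambda>\<omega>. \<Sum>a\<in>?A. indicator (E a) \<omega> * F (shape_seq a n))"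
    by (intro Bochner_Integration.integrable_sum)
  have eq: "F (tree n \<omega>) = (\<Sum>a\<in>?A. indicator (E a) \<omega> * F (shape_seq a n))" if "\<omega> \<in> space M" for \<omega>
    unfolding E_def by (rule tree_eq_sum[OF that, of F n])
  show "integrable M (\<lambda>\<omega>. F (tree n \<omega>))"
    by (rule Bochner_Integration.integrable_cong[OF refl eq, THEN iffD2, OF _ int_sum])
  have "expectation (\<lambda>\<omega>. F (tree n \<omega>)) = expectation (\<lambda>\<omega>. \<Sum>a\<in>?A. indicator (E a) \<omega> * F (shape_seq a n))"
    by (rule Bochner_Integration.integral_cong[OF refl eq])
  also have "\<dots> = (\<Sum>a\<in>?A. expectation (\<lambda>\<omega>. indicator (E a) \<omega> * F (shape_seq a n)))"
    using int by (rule Bochner_Integration.integral_sum)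
  also have "\<dots> = (\<Sum>a\<in>?A. 1 / fact n * F (shape_seq a n))"
  proof (intro sum.cong refl)
    fix a assume a: "a \<in> ?A"
    have "expectation (\<lambda>\<omega>. indicator (E a) \<omega> * F (shape_seq a n)) = expectation (indicator (E a)) * F (shape_seq a n)"
      by (rule integral_mult_left_zero)
    also have "expectation (indicator (E a)) = prob (E a \<inter> space M)" by (rule Bochner_Integration.integral_indicator)
    also have "E a \<inter> space M = E a" by (rule Int_absorb2[OF sets.sets_into_space[OF E]])
    also have "prob (E a) = 1 / fact n" unfolding E_def by (rule prob_rel_rank[OF indep ident cont a])
    finally show "expectation (\<lambda>\<omega>. indicator (E a) \<omega> * F (shape_seq a n)) = 1 / fact n * F (shape_seq a n)" .
  qed
  also have "\<dots> = expect n F" unfolding expect_eq_sum by (simp add: sum_divide_distrib)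
  finally show "expectation (\<lambda>\<omega>. F (tree n \<omega>)) = expect n F" .
qed

text \<open>The mean of \<open>(V (tree n \<omega>))\<^sup>2 / (n + 1) ^ 3\<close> is
  \<open>O(n powr (\<beta> - 3))\<close>, summable because \<open>\<beta> < 2\<close>. So the random
  series has finite mean, converges almost surely, and
  \<open>tendsto_zero_of_weighted_squares\<close> applies to each such path.\<close>

lemma AE_tendsto:
  assumes lip: "lipschitz Z" and conc: "concentrates \<beta> Z z" and "\<beta> < 2"
  shows "AE \<omega> in M. (\<lambda>n. Z (tree n \<omega>) / (real n + 1)) \<longlonglongrightarrow> z"
proof -
  define V where "V s = Z s - z * (real (ssize s) + 1)" for s
  obtain C where C: "\<And>n. expect n (\<lambda>s. (V s)\<^sup>2) \<le> C * (real n + 1) powr \<beta>"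
    using conc unfolding concentrates_def V_def by blast
  obtain K where K: "\<And>s r. wf_shape s \<Longrightarrow> r \<le> ssize s \<Longrightarrow> \<bar>V (grow r s) - V s\<bar> \<le> K"
    using lipschitz_centered[OF lip, of z] unfolding lipschitz_def V_def by blast
  let ?f = "\<lambda>n \<omega>. (V (tree n \<omega>))\<^sup>2 / (real n + 1) ^ 3"
  have int: "integrable M (?f n)" for n
    by (rule integrable_tree[of "\<lambda>s. (V s)\<^sup>2 / (real n + 1) ^ 3"])
  then have meas: "(\<lambda>\<omega>. ennreal (?f n \<omega>)) \<in> borel_measurable M" for n
    by (intro measurable_compose[OF _ measurable_ennreal] borel_measurable_integrable)
  have nn: "(\<integral>\<^sup>+\<omega>. ennreal (?f n \<omega>) \<partial>M) = ennreal (expect n (\<lambda>s. (V s)\<^sup>2) / (real n + 1) ^ 3)" for n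
  proof -
    have "(\<integral>\<^sup>+\<omega>. ennreal (?f n \<omega>) \<partial>M) = ennreal (expectation (?f n))"
      using int by (rule nn_integral_eq_integral) simp
    also have "expectation (?f n) = expect n (\<lambda>s. 1 / (real n + 1) ^ 3 * (V s)\<^sup>2)"
      using expectation_tree[of "\<lambda>s. 1 / (real n + 1) ^ 3 * (V s)\<^sup>2"] by simp
    finally show ?thesis unfolding expect_scale by simp
  qed
  have nonneg: "0 \<le> expect n (\<lambda>s. (V s)\<^sup>2) / (real n + 1) ^ 3" for n
    using expect_mono[of n "\<lambda>s. 0" "\<lambda>s. (V s)\<^sup>2"] by (simp add: expect_const)
  have "summable (\<lambda>n. expect n (\<lambda>s. (V s)\<^sup>2) / (real n + 1) ^ 3)"
  proof (rule summable_comparison_test')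
    have "summable (\<lambda>n. real n powr (\<beta> - 3))" using assms(3) by (simp add: summable_real_powr_iff)
    then have "summable (\<lambda>n. real (Suc n) powr (\<beta> - 3))" by (subst summable_Suc_iff)
    then show "summable (\<lambda>n. C * (real n + 1) powr (\<beta> - 3))"
      by (intro summable_mult) (simp add: add.commute)
    fix n :: nat
    have "expect n (\<lambda>s. (V s)\<^sup>2) / (real n + 1) ^ 3 \<le> C * (real n + 1) powr \<beta> / (real n + 1) ^ 3"
      using C by (intro divide_right_mono) auto
    also have "\<dots> = C * (real n + 1) powr (\<beta> - 3)"
      by (simp add: powr_diff powr_numeral)
    finally show "norm (expect n (\<lambda>s. (V s)\<^sup>2) / (real n + 1) ^ 3) \<le> C * (real n + 1) powr (\<beta> - 3)"
      using nonneg[of n] by simp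
  qed
  then have "(\<Sum>n. ennreal (expect n (\<lambda>s. (V s)\<^sup>2) / (real n + 1) ^ 3)) \<noteq> \<top>"
    using nonneg by (rule ennreal_suminf_neq_top)
  then have "(\<integral>\<^sup>+\<omega>. (\<Sum>n. ennreal (?f n \<omega>)) \<partial>M) \<noteq> \<infinity>"
    using meas by (subst nn_integral_suminf) (simp_all add: nn)
  moreover have "(\<lambda>\<omega>. \<Sum>n. ennreal (?f n \<omega>)) \<in> borel_measurable M"
    using meas by (rule borel_measurable_suminf_order)
  ultimately have "AE \<omega> in M. (\<Sum>n. ennreal (?f n \<omega>)) \<noteq> \<infinity>" by (intro nn_integral_PInf_AE)
  then show ?thesis
  proof eventually_elim
    case (elim \<omega>)
    have "summable (\<lambda>n. ?f n \<omega>)"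
      using elim by (intro summable_suminf_not_top) auto
    moreover have "\<bar>V (tree (Suc n) \<omega>) - V (tree n \<omega>)\<bar> \<le> K" for n
      unfolding tree_Suc by (rule K) (simp_all add: tree_wf rel_rank_le)
    ultimately have "(\<lambda>n. V (tree n \<omega>) / (real n + 1)) \<longlonglongrightarrow> 0"
      by (intro tendsto_zero_of_weighted_squares)
    then have "(\<lambda>n. V (tree n \<omega>) / (real n + 1) + z) \<longlonglongrightarrow> 0 + z" by (intro tendsto_intros)
    moreover have "V (tree n \<omega>) / (real n + 1) + z = Z (tree n \<omega>) / (real n + 1)" for n
    proof -
      have "(a - z * x) / x + z = a / x" if "x > 0" for a x :: real using that by (simp add: field_simps)
      from this[of "real n + 1" "Z (tree n \<omega>)"] show ?thesis by (simp add: V_def tree_wf)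
    qed
    ultimately show ?case by simp
  qed
qed

lemma AE_protected_fraction:
  "AE \<omega> in M. (\<lambda>n. protected_fraction 2 (nodes (search_tree m (map (\<lambda>i. X i \<omega>) [0..<n]))))
    \<longlonglongrightarrow> (\<Sum>\<sigma>\<in>protected_profiles. profile_density \<sigma>) / (size_const / 2)"
proof -
  obtain \<beta> where \<beta>: "\<beta> < 2" "concentrates \<beta> node_count (size_const / 2)"
    "concentrates \<beta> protected_count (\<Sum>\<sigma>\<in>protected_profiles. profile_density \<sigma>)"
    using concentrates_counts by blast
  show ?thesis
    using AE_distinct[OF indep ident cont] AE_tendsto[OF lipschitz_node_count \<beta>(2,1)]
      AE_tendsto[OF lipschitz_protected_count \<beta>(3,1)]
  proof eventually_elim
    case (elim \<omega>)
    have "(\<lambda>n. (protected_count (tree n \<omega>) / (real n + 1)) / (node_count (tree n \<omega>) / (real n + 1)))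
      \<longlonglongrightarrow> (\<Sum>\<sigma>\<in>protected_profiles. profile_density \<sigma>) / (size_const / 2)"
      by (rule tendsto_divide[OF elim(3,2)]) (use size_const_pos in simp)
    moreover have "(a / x) / (b / x) = a / b" if "x > 0" for a b x :: real using that by simp
    ultimately show ?case
      unfolding protected_fraction_search_tree[OF elim(1)] tree_def by (simp add: add_pos_nonneg)
  qed
qed

end

theorem theorem10p3:
  fixes M :: "'a measure" and X :: "nat \<Rightarrow> 'a \<Rightarrow> real" and D :: "real measure" and m :: nat
  assumes "prob_space M"
    and "prob_space.indep_vars M (\<lambda>_. borel) X UNIV"
    and "\<And>i. distr M borel (X i) = D"
    and "continuous_on UNIV (cdf D)"
    and "m \<ge> 2"
  shows "AE \<omega> in M.
    (\<lambda>n. protected_fraction 2 (nodes (search_tree m (map (\<lambda>i. X i \<omega>) [0..<n]))))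
      \<longlonglongrightarrow> 2 / real m * (\<Sum>l = 0..m - 1. (fact m :: real) / fact (m - l)
                        * (fact (m * (m - l)) / fact (m * (m - l) + l + 1)))"
proof -
  interpret prob_space M by (rule assms(1))
  interpret random_search_tree M m X D
    using assms by unfold_locales
  \<comment> \<open>Profile limits carry the factor \<open>size_const / m\<close>, the number of
    nodes per gap tends to \<open>size_const / 2\<close>; hence the \<open>2 / m\<close>.\<close>
  have "size_const / real m * c / (size_const / 2) = 2 / real m * c" for c
    using size_const_pos by (simp add: field_simps)
  then show ?thesis using AE_protected_fraction unfolding sum_profile_density_protected by (simp only:)
qed

end
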